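(* There is a tame set $U_1$ consisting of time bounds of Type 1 such that \[\mathcal{B}_{\mathrm{lin}}\cup\mathcal{B}_{\log^*}\cup\bigcup\nolimits_{m\in\mathbb{N}^+}\mathcal{B}_{\mathrm{qlin}}^{(m)}\cup\mathcal{B}_{\mathrm{pol}}\ \hookrightarrow_{\mathrm{it}}\ U_1\] and $U_1$ is densely linearly ordered by $\le_{\mathrm{it}}$. Moreover, if $\beta_i(n)=n\cdot\alpha_i(n)$ for $i=1,2$ with $\beta_1,\beta_2\in U_1$ (and $\alpha_i$ the factor functions of the Type 1 representation), then $\beta_1\prec_{\mathrm{it}}\beta_2$ if and only if $\alpha_1\ll_{\mathrm{pow}}\alpha_2$.
   Context: A (time) bound is a function $\beta:\mathbb{N}\to\mathbb{N}$ with $n\le\beta(n)\le\beta(n+1)$ for all $n$ (here $0\in\mathbb{N}$, $\mathbb{N}^+=\mathbb{N}\setminus\{0\}$). For functions $f,g$ into numbers, $f\le_a g$ means $f(n)\le g(n)$ for almost all $n$; powers $f^k(n)=(f(n))^k$, while $f^{\langle m\rangle}$ is the $m$-fold iterate. For sets of bounds, $B_1\le_a B_2$ means every $\beta_1\in B_1$ satisfies $\beta_1\le_a\beta_2$ for some $\beta_2\in B_2$. $\mathrm{It}(\beta)=\{\beta^{\langle m\rangle}:m\in\mathbb{N}^+\}$. $\beta_1\le_{\mathrm{it}}\beta_2$ means $\mathrm{It}(\beta_1)\le_a\mathrm{It}(\beta_2)$; $\beta_1\equiv_{\mathrm{it}}\beta_2$ means both directions; $\beta_1\prec_{\mathrm{it}}\beta_2$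 means $\beta_1\le_{\mathrm{it}}\beta_2$ but not $\beta_1\equiv_{\mathrm{it}}\beta_2$. For sets of bounds, $U\hookrightarrow_{\mathrm{it}}U'$ means every $\beta\in U$ is $\equiv_{\mathrm{it}}$ to some element of $U'$. "$U$ is densely linearly ordered by $\le_{\mathrm{it}}$" means: for distinct $\beta_1,\beta_2\in U$ exactly one of $\beta_1\prec_{\mathrm{it}}\beta_2$, $\beta_2\prec_{\mathrm{it}}\beta_1$ holds, and whenever $\beta_1\prec_{\mathrm{it}}\beta_2$ there is $\beta_3\in U$ with $\beta_1\prec_{\mathrm{it}}\beta_3\prec_{\mathrm{it}}\beta_2$. A set $U$ of bounds is tame if for all $\beta_1,\beta_2\in U$ the limit $\lim_{n\to\infty,n>0}\beta_1(n)/\beta_2(n)$ exists in $\mathbb{R}\cup\{\infty\}$. Logarithms: $\log(n)=\lceil\log_2 n\rceil$ for $n\ge2$, $\log(0)=\log(1)=1$; $\log^{\langle m\rangle}$ its $m$-fold iterate; $\log^*(n)=\min\{m:\log^{\langle m\rangle}(n)=1\}$. Bound sets: $\mathcal{B}_{\mathrm{lin}}=\{c\cdot n:c\in\mathbb{N}^+\}$, $\mathcal{B}_{\mathrm{pol}}=\{n^k:k\in\mathbb{N}^+\}$, $\mathcal{B}_{\mathrm{qlin}}^{(m)}=\{n(\log^{\langle m\rangle}(n))^k:k\in\mathbb{N}^+\}$, $\mathcal{B}_{\log^*}=\{n(\log^*(n))^k:k\in\mathbb{N}^+\}$. For $\alpha_1,\alpha_2:\mathbb{N}\to\mathbb{N}$: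 $\alpha_1\ll_{\mathrm{pow}}\alpha_2$ means $\alpha_1^k\le_a\alpha_2$ for all $k\in\mathbb{N}$. A function $\alpha:\mathbb{N}\to\mathbb{N}$ is f-consistent if for every $k\in\mathbb{N}$ there is $l\in\mathbb{N}$ with $\alpha(n^k)\le(\alpha(n))^l$ for almost all $n$. $\alpha$ is constructible in linear time if $w\mapsto 1^{\alpha(|w|)}$ is computable by a deterministic multitape Turing machine with output tape in time $O(|w|)$. A bound $\beta$ is of Type 1 if $\beta(n)=n\cdot\alpha(n)$ with $\alpha$ nondecreasing, $2\le_a\alpha(n)\le_a n$, f-consistent, and constructible in linear time.
   Formalization: The identity bound n (the case c=1 of B_lin and k=1 of B_pol) is removed from the union that embeds into U_1, since It(n)={n} while every Type 1 bound is at least 2n almost everywhere, so n is not equivalent to any Type 1 bound. *)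

theory Defs
  imports Complex_Main
begin

section \<open>Time bounds and their comparison\<close>

definition is_bound :: "(nat \<Rightarrow> nat) \<Rightarrow> bool" where
  "is_bound \<beta> \<longleftrightarrow> (\<forall>n. n \<le> \<beta> n \<and> \<beta> n \<le> \<beta> (n + 1))"

definition le_ae :: "(nat \<Rightarrow> nat) \<Rightarrow> (nat \<Rightarrow> nat) \<Rightarrow> bool"  (infix \<open>\<le>\<^sub>a\<close> 50) where
  "f \<le>\<^sub>a g \<longleftrightarrow> (\<forall>\<^sub>F n in sequentially. f n \<le> g n)"

definition set_le_ae :: "(nat \<Rightarrow> nat) set \<Rightarrow> (nat \<Rightarrow> nat) set \<Rightarrow> bool" where
  "set_le_ae B1 B2 \<longleftrightarrow> (\<forall>\<beta>1\<in>B1. \<exists>\<beta>2\<in>B2. \<beta>1 \<le>\<^sub>a \<beta>2)"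

definition It :: "(nat \<Rightarrow> nat) \<Rightarrow> (nat \<Rightarrow> nat) set" where
  "It \<beta> = {\<beta> ^^ m |m. m \<ge> 1}"

definition le_it :: "(nat \<Rightarrow> nat) \<Rightarrow> (nat \<Rightarrow> nat) \<Rightarrow> bool"  (infix \<open>\<le>\<^sub>i\<^sub>t\<close> 50) where
  "\<beta>1 \<le>\<^sub>i\<^sub>t \<beta>2 \<longleftrightarrow> set_le_ae (It \<beta>1) (It \<beta>2)"

definition equiv_it :: "(nat \<Rightarrow> nat) \<Rightarrow> (nat \<Rightarrow> nat) \<Rightarrow> bool"  (infix \<open>\<equiv>\<^sub>i\<^sub>t\<close> 50) where
  "\<beta>1 \<equiv>\<^sub>i\<^sub>t \<beta>2 \<longleftrightarrow> \<beta>1 \<le>\<^sub>i\<^sub>t \<beta>2 \<and> \<beta>2 \<le>\<^sub>i\<^sub>t \<beta>1"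

definition less_it :: "(nat \<Rightarrow> nat) \<Rightarrow> (nat \<Rightarrow> nat) \<Rightarrow> bool"  (infix \<open>\<prec>\<^sub>i\<^sub>t\<close> 50) where
  "\<beta>1 \<prec>\<^sub>i\<^sub>t \<beta>2 \<longleftrightarrow> \<beta>1 \<le>\<^sub>i\<^sub>t \<beta>2 \<and> \<not> \<beta>1 \<equiv>\<^sub>i\<^sub>t \<beta>2"

definition embeds_it :: "(nat \<Rightarrow> nat) set \<Rightarrow> (nat \<Rightarrow> nat) set \<Rightarrow> bool"
    (infix \<open>\<hookrightarrow>\<^sub>i\<^sub>t\<close> 50) where
  "U \<hookrightarrow>\<^sub>i\<^sub>t U' \<longleftrightarrow> (\<forall>\<beta>\<in>U. \<exists>\<beta>'\<in>U'. \<beta> \<equiv>\<^sub>i\<^sub>t \<beta>')"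

definition densely_linearly_ordered_it :: "(nat \<Rightarrow> nat) set \<Rightarrow> bool" where
  "densely_linearly_ordered_it U \<longleftrightarrow>
     (\<forall>\<beta>1\<in>U. \<forall>\<beta>2\<in>U. \<beta>1 \<noteq> \<beta>2 \<longrightarrow>
        (\<beta>1 \<prec>\<^sub>i\<^sub>t \<beta>2 \<or> \<beta>2 \<prec>\<^sub>i\<^sub>t \<beta>1) \<and> \<not> (\<beta>1 \<prec>\<^sub>i\<^sub>t \<beta>2 \<and> \<beta>2 \<prec>\<^sub>i\<^sub>t \<beta>1)) \<and>
     (\<forall>\<beta>1\<in>U. \<forall>\<beta>2\<in>U. \<beta>1 \<prec>\<^sub>i\<^sub>t \<beta>2 \<longrightarrow> (\<exists>\<beta>3\<in>U. \<beta>1 \<prec>\<^sub>i\<^sub>t \<beta>3 \<and> \<beta>3 \<prec>\<^sub>i\<^sub>t \<beta>2))"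

text \<open>Bounds are positive at every positive argument, so the convention for division by zero
  can affect the quotient below at \<open>n = 0\<close> only.\<close>

definition tame :: "(nat \<Rightarrow> nat) set \<Rightarrow> bool" where
  "tame U \<longleftrightarrow> (\<forall>\<beta>\<in>U. is_bound \<beta>) \<and>
     (\<forall>\<beta>1\<in>U. \<forall>\<beta>2\<in>U.
        (\<exists>l::real. (\<lambda>n. real (\<beta>1 n) / real (\<beta>2 n)) \<longlonglongrightarrow> l) \<or>
        filterlim (\<lambda>n. real (\<beta>1 n) / real (\<beta>2 n)) at_top sequentially)"

definition ll_pow :: "(nat \<Rightarrow> nat) \<Rightarrow> (nat \<Rightarrow> nat) \<Rightarrow> bool"  (infix \<open>\<lless>\<^sub>p\<^sub>o\<^sub>w\<close> 50) where
  "\<alpha>1 \<lless>\<^sub>p\<^sub>o\<^sub>w \<alpha>2 \<longleftrightarrow> (\<forall>k::nat. (\<lambda>n. \<alpha>1 n ^ k) \<le>\<^sub>a \<alpha>2)"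


section \<open>Particular sets of bounds\<close>

definition lg :: "nat \<Rightarrow> nat" where
  "lg n = (if n \<ge> 2 then nat \<lceil>log 2 (real n)\<rceil> else 1)"

text \<open>\<open>m = 0\<close> is admitted here, so \<open>lgstar 1 = 0\<close>.\<close>

definition lgstar :: "nat \<Rightarrow> nat" where
  "lgstar n = (LEAST m. (lg ^^ m) n = 1)"

definition B_lin :: "(nat \<Rightarrow> nat) set" where
  "B_lin = {(\<lambda>n. c * n) |c. c \<ge> 1}"

definition B_pol :: "(nat \<Rightarrow> nat) set" where
  "B_pol = {(\<lambda>n. n ^ k) |k. k \<ge> 1}"

definition B_qlin :: "nat \<Rightarrow> (nat \<Rightarrow> nat) set" where
  "B_qlin m = {(\<lambda>n. n * ((lg ^^ m) n) ^ k) |k. k \<ge> 1}"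

definition B_lgstar :: "(nat \<Rightarrow> nat) set" where
  "B_lgstar = {(\<lambda>n. n * (lgstar n) ^ k) |k. k \<ge> 1}"


section \<open>Deterministic multitape Turing machines with an output tape\<close>

text \<open>States are the numbers below \<open>num_states\<close>, with initial state \<open>0\<close>; tape symbols are the
  numbers below \<open>num_symbols\<close>, with \<open>0\<close> the blank.  The tapes are two-way infinite; tape \<open>0\<close> is the
  input tape, tape \<open>1\<close> the output tape, and all others are work tapes.  The transition function
  maps the state and the list of scanned symbols to the next state and, for each tape, the symbol
  to be written and the head movement in \<open>{-1, 0, 1}\<close>; the machine halts when it is
  undefined.\<close>

record tm =
  num_tapes :: nat
  num_states :: nat
  num_symbols :: nat
  trans :: "nat \<Rightarrow> nat list \<Rightarrow> (nat \<times> (nat \<times> int) list) option"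

text \<open>At least three symbols are needed: the blank and the two letters of the input alphabet.\<close>

definition wf_tm :: "tm \<Rightarrow> bool" where
  "wf_tm M \<longleftrightarrow> num_tapes M \<ge> 2 \<and> num_states M \<ge> 1 \<and> num_symbols M \<ge> 3 \<and>
     (\<forall>q ss q' as. q < num_states M \<longrightarrow> length ss = num_tapes M \<longrightarrow>
        (\<forall>s\<in>set ss. s < num_symbols M) \<longrightarrow> trans M q ss = Some (q', as) \<longrightarrow>
        q' < num_states M \<and> length as = num_tapes M \<and>
        (\<forall>(s, d)\<in>set as. s < num_symbols M \<and> d \<in> {-1, 0, 1}))"

text \<open>A tape is a pair of the head position and the cell contents.\<close>

type_synonym tape = "int \<times> (int \<Rightarrow> nat)"
type_synonym config = "nat \<times> tape list"

definition scan :: "tape \<Rightarrow> nat" where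
  "scan t = snd t (fst t)"

definition act :: "nat \<times> int \<Rightarrow> tape \<Rightarrow> tape" where
  "act a t = (fst t + snd a, (snd t)(fst t := fst a))"

definition halted :: "tm \<Rightarrow> config \<Rightarrow> bool" where
  "halted M c \<longleftrightarrow> trans M (fst c) (map scan (snd c)) = None"

definition step :: "tm \<Rightarrow> config \<Rightarrow> config" where
  "step M c = (case trans M (fst c) (map scan (snd c)) of
      None \<Rightarrow> c
    | Some (q', as) \<Rightarrow> (q', map2 act as (snd c)))"

text \<open>Words over \<open>{0, 1}\<close> are lists of Booleans, the letter \<open>0\<close> (\<open>False\<close>) being represented by
  the tape symbol \<open>1\<close> and the letter \<open>1\<close> (\<open>True\<close>) by the tape symbol \<open>2\<close>.\<close>

definition sym :: "bool \<Rightarrow> nat" where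
  "sym b = (if b then 2 else 1)"

definition word_cells :: "bool list \<Rightarrow> int \<Rightarrow> nat" where
  "word_cells w i = (if 0 \<le> i \<and> i < int (length w) then sym (w ! nat i) else 0)"

definition init :: "tm \<Rightarrow> bool list \<Rightarrow> config" where
  "init M w = (0, (0, word_cells w) # replicate (num_tapes M - 1) (0, \<lambda>_. 0))"

definition output_is :: "config \<Rightarrow> bool list \<Rightarrow> bool" where
  "output_is c v \<longleftrightarrow> snd (snd c ! 1) = word_cells v"

text \<open>A halted configuration is a fixed point of \<open>step M\<close>, so \<open>halted\<close> after exactly \<open>t\<close>
  iterations means that the computation takes at most \<open>t\<close> steps.\<close>

definition computes_in_time ::
    "tm \<Rightarrow> (bool list \<Rightarrow> bool list) \<Rightarrow> (nat \<Rightarrow> nat) \<Rightarrow> bool" where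
  "computes_in_time M f T \<longleftrightarrow>
     (\<forall>w. \<exists>t \<le> T (length w).
        halted M ((step M ^^ t) (init M w)) \<and>
        output_is ((step M ^^ t) (init M w)) (f w))"

text \<open>Time \<open>O(n)\<close> is \<open>c * n + c\<close> rather than \<open>c * n\<close> because of the empty word.\<close>

definition linear_time_constructible :: "(nat \<Rightarrow> nat) \<Rightarrow> bool" where
  "linear_time_constructible \<alpha> \<longleftrightarrow>
     (\<exists>M c. wf_tm M \<and>
        computes_in_time M (\<lambda>w. replicate (\<alpha> (length w)) True) (\<lambda>n. c * n + c))"


section \<open>Bounds of Type 1\<close>

definition f_consistent :: "(nat \<Rightarrow> nat) \<Rightarrow> bool" where
  "f_consistent \<alpha> \<longleftrightarrow> (\<forall>k::nat. \<exists>l::nat. (\<lambda>n. \<alpha> (n ^ k)) \<le>\<^sub>a (\<lambda>n. \<alpha> n ^ l))"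

definition type1_factor :: "(nat \<Rightarrow> nat) \<Rightarrow> (nat \<Rightarrow> nat) \<Rightarrow> bool" where
  "type1_factor \<alpha> \<beta> \<longleftrightarrow> is_bound \<beta> \<and> (\<forall>n. \<beta> n = n * \<alpha> n) \<and> mono \<alpha> \<and>
     (\<lambda>n. 2) \<le>\<^sub>a \<alpha> \<and> \<alpha> \<le>\<^sub>a (\<lambda>n. n) \<and> f_consistent \<alpha> \<and> linear_time_constructible \<alpha>"

definition type1 :: "(nat \<Rightarrow> nat) \<Rightarrow> bool" where
  "type1 \<beta> \<longleftrightarrow> (\<exists>\<alpha>. type1_factor \<alpha> \<beta>)"

text \<open>The identity, which is in \<^term>\<open>B_lin\<close> and \<^term>\<open>B_pol\<close>, has only itself as an iterate, whereas
  bounds of Type 1 eventually dominate \<open>2 * n\<close>. Hence it has to be excluded from any embedding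
  into a set of bounds of Type 1.\<close>

lemma identity_not_equiv_type1:
  assumes "type1 \<beta>"
  shows "\<not> (\<lambda>n. n) \<equiv>\<^sub>i\<^sub>t \<beta>"
proof
  assume eq: "(\<lambda>n. n) \<equiv>\<^sub>i\<^sub>t \<beta>"
  from assms obtain \<alpha> where b: "\<And>n. \<beta> n = n * \<alpha> n" and a: "(\<lambda>n. 2) \<le>\<^sub>a \<alpha>"
    by (auto simp: type1_def type1_factor_def)
  have "((\<lambda>n. n) ^^ m) = (\<lambda>n::nat. n)" for m
    by (induction m) auto
  then have It_id: "It (\<lambda>n. n) = {\<lambda>n. n}"
    by (auto simp: It_def)
  have "\<beta> ^^ 1 \<in> It \<beta>"
    unfolding It_def by blast
  then have "\<beta> \<in> It \<beta>"
    by simp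
  with eq have "\<beta> \<le>\<^sub>a (\<lambda>n. n)"
    by (auto simp: equiv_it_def le_it_def set_le_ae_def It_id)
  with a have "\<forall>\<^sub>F n in sequentially. \<beta> n \<le> n \<and> 2 \<le> \<alpha> n \<and> n \<ge> 1"
    unfolding le_ae_def by (intro eventually_conj eventually_ge_at_top)
  then obtain n where n: "\<beta> n \<le> n" "2 \<le> \<alpha> n" "n \<ge> 1"
    by (auto simp: eventually_sequentially)
  then have "n * 2 \<le> n * \<alpha> n"
    by (intro mult_le_mono2)
  with n b show False
    by simp
qed

end

theory Submission
  imports Defs
begin

text \<open>Between bounds \<open>n * \<alpha> n\<close> with f-consistent \<open>\<alpha>\<close>, the iteration order only compares the
  factors \<open>\<alpha>\<close> up to powers. If \<open>\<alpha>1 \<lless>\<^sub>p\<^sub>o\<^sub>w \<alpha>2\<close>, then the geometric mean of the logarithms,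
  that is \<open>2 ^ \<lceil>sqrt (lg \<alpha>1 * lg \<alpha>2)\<rceil>\<close>, lies strictly between the two factors, and it inherits
  monotonicity, f-consistency and constructibility in linear time. Hence the admissible factors are
  dense under \<open>\<lless>\<^sub>p\<^sub>o\<^sub>w\<close>, and by Zorn's lemma every chain of them extends to a maximal chain, which
  must then itself be dense. Start from the chain of the factors representing \<open>B_lin\<close>,
  \<open>B_lgstar\<close>, \<open>B_qlin m\<close> and \<open>B_pol\<close>; tameness is automatic, since \<open>\<alpha>1 \<lless>\<^sub>p\<^sub>o\<^sub>w \<alpha>2\<close> forces the
  quotient of the bounds to tend to \<open>0\<close>. Constructibility is checked on counter programs, which a
  Turing machine simulates in real time by storing each counter as a head position.\<close>

section \<open>Counter programs and their simulation by Turing machines\<close>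

text \<open>The relation \<open>ll_pow\<close> is not total on admissible factors: the constants 2
  and 3 are incomparable. Since distinct members of \<open>U1\<close> must be strictly comparable,
  only one factor per class modulo powers may enter, and closing the initial chain under midpoints
  directly would mean comparing all the resulting factors. In a maximal chain only a gap has to be
  filled, and comparability with everything else then comes from transitivity. f-consistency is what
  reduces iterates to powers: the iterates of \<open>n * \<alpha> n\<close> stay below a power of
  \<open>n\<close>, at which \<alpha> has grown only to a power of \<open>\<alpha> n\<close>. The
  geometric mean is chosen because it splits the quotient \<open>lg y / lg x\<close> into two nearly
  equal quotients, so both are unbounded when their product is. Being at most the larger logarithm,
  it also keeps the resulting power of two linear in the two factors. A head position can only be
  tested for zero, so all arithmetic is unary; linear time rests on geometric series and on
  logarithms being small.\<close>

datatype prog = Inc nat | Dec nat | Seq prog prog (infixr \<open>;;\<close> 60) | While nat prog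

text \<open>Time counts executed instructions: a loop test is one \<open>JZ\<close>, and each pass
  ends with one \<open>JMP\<close>, hence the two extra units in \<open>While_pos\<close>.\<close>

inductive run :: "prog \<Rightarrow> (nat \<Rightarrow> nat) \<Rightarrow> nat \<Rightarrow> (nat \<Rightarrow> nat) \<Rightarrow> bool" where
  Inc: "run (Inc i) s 1 (s(i := s i + 1))"
| Dec: "run (Dec i) s 1 (s(i := s i - 1))"
| Seq: "run p s t s' \<Longrightarrow> run q s' t' s'' \<Longrightarrow> run (p ;; q) s (t + t') s''"
| While_zero: "s i = 0 \<Longrightarrow> run (While i p) s 1 s"
| While_pos: "s i \<noteq> 0 \<Longrightarrow> run p s t s' \<Longrightarrow> run (While i p) s' t' s'' \<Longrightarrow>
    run (While i p) s (1 + t + 1 + t') s''"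

datatype instr = Mark | INC nat | DEC nat | JZ nat nat | JMP nat

text \<open>Jump targets are absolute, so the first argument is the address at which the code is
  placed; the offset 2 skips the \<open>JZ\<close> itself and the closing
  \<open>JMP\<close>.\<close>

fun compile :: "nat \<Rightarrow> prog \<Rightarrow> instr list" where
  "compile l (Inc i) = [INC i]"
| "compile l (Dec i) = [DEC i]"
| "compile l (p ;; q) = compile l p @ compile (l + length (compile l p)) q"
| "compile l (While i p) = JZ i (l + length (compile (l + 1) p) + 2) # compile (l + 1) p @ [JMP l]"

text \<open>Register \<open>0\<close> is the number of unread input symbols, register \<open>1\<close> the length of the output.
  Register \<open>i \<ge> 2\<close> is the head position on tape \<open>i\<close>, which is blank except for a \<open>1\<close> in cell \<open>0\<close>
  written by \<open>Mark\<close>; so testing a register for zero means looking at the scanned symbol.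
  Register \<open>0\<close> cannot be incremented, and register \<open>1\<close> neither decremented nor tested.\<close>

definition zero_sym :: "nat \<Rightarrow> nat \<Rightarrow> bool" where
  "zero_sym i x \<longleftrightarrow> x = (if i = 0 then 0 else 1)"

fun tape_action :: "instr \<Rightarrow> nat \<Rightarrow> nat \<Rightarrow> nat \<times> int" where
  "tape_action Mark i x = (if i \<ge> 2 then 1 else x, 0)"
| "tape_action (INC j) i x = (if i = j then (if i = 1 then 2 else x, 1) else (x, 0))"
| "tape_action (DEC j) i x =
    (x, if i = j \<and> \<not> zero_sym i x then (if i = 0 then 1 else - 1) else 0)"
| "tape_action _ i x = (x, 0)"

fun target :: "instr \<Rightarrow> nat \<Rightarrow> nat list \<Rightarrow> nat" where
  "target (JZ j l) q ss = (if zero_sym j (ss ! j) then l else q + 1)"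
| "target (JMP l) q ss = l"
| "target _ q ss = q + 1"

text \<open>State \<open>length P\<close> is the halting state. Capping targets by
  \<open>min\<close> keeps every transition inside the state set, whatever jumps \<open>P\<close>
  contains.\<close>

definition tm_of :: "nat \<Rightarrow> instr list \<Rightarrow> tm" where
  "tm_of K P = \<lparr>num_tapes = K, num_states = length P + 1, num_symbols = 3,
     trans = \<lambda>q ss. if q < length P
       then Some (min (length P) (target (P ! q) q ss), map (\<lambda>i. tape_action (P ! q) i (ss ! i)) [0..<K])
       else None\<rparr>"

lemma wf_tm_of: "K \<ge> 2 \<Longrightarrow> wf_tm (tm_of K P)"
proof -
  have *: "fst (tape_action I i x) < 3 \<and> snd (tape_action I i x) \<in> {-1, 0, 1}" if "x < 3" for I i x
    using that by (cases "(I, i, x)" rule: tape_action.cases) auto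
  assume "K \<ge> 2"
  then show ?thesis
    using * by (fastforce simp: wf_tm_def tm_of_def case_prod_unfold split: if_splits)
qed

definition tape_of :: "bool list \<Rightarrow> nat \<Rightarrow> nat \<Rightarrow> tape" where
  "tape_of w i v = (if i = 0 then (int (length w - v), word_cells w)
     else if i = 1 then (int v, word_cells (replicate v True))
     else (int v, (\<lambda>_. 0)(0 := 1)))"

definition conf :: "nat \<Rightarrow> bool list \<Rightarrow> nat \<Rightarrow> (nat \<Rightarrow> nat) \<Rightarrow> config" where
  "conf K w q S = (q, map (\<lambda>i. tape_of w i (S i)) [0..<K])"

text \<open>The input head is past the last letter exactly when nothing is unread. The side
  condition guards the truncated difference \<open>length w - v\<close> in
  \<open>tape_of\<close>.\<close>

lemma zero_sym_scan:
  "i \<noteq> 1 \<Longrightarrow> (i = 0 \<longrightarrow> v \<le> length w) \<Longrightarrow> zero_sym i (scan (tape_of w i v)) \<longleftrightarrow> v = 0"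
  by (auto simp: zero_sym_def scan_def tape_of_def word_cells_def sym_def)

lemma act_idle: "act (scan t, 0) t = t"
  by (simp add: act_def scan_def)

lemma act_move: "act (scan t, d) t = (fst t + d, snd t)"
  by (simp add: act_def scan_def)

lemma step_conf:
  assumes q: "q < length P"
    and T: "\<And>i. i < K \<Longrightarrow>
      act (tape_action (P ! q) i (scan (tape_of w i (S i)))) (tape_of w i (S i)) = tape_of w i (S' i)"
    and q': "target (P ! q) q (map (\<lambda>i. scan (tape_of w i (S i))) [0..<K]) = q'" "q' \<le> length P"
  shows "step (tm_of K P) (conf K w q S) = conf K w q' S'"
proof -
  have "map2 act (map (\<lambda>i. tape_action (P ! q) i (map (\<lambda>i. scan (tape_of w i (S i))) [0..<K] ! i)) [0..<K])
      (map (\<lambda>i. tape_of w i (S i)) [0..<K]) = map (\<lambda>i. tape_of w i (S' i)) [0..<K]"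
    by (rule nth_equalityI) (auto simp: T)
  then show ?thesis
    using q q' by (simp add: step_def conf_def tm_of_def o_def)
qed

lemma step_INC:
  assumes "q < length P" "P ! q = INC j" "j \<noteq> 0"
  shows "step (tm_of K P) (conf K w q S) = conf K w (q + 1) (S(j := S j + 1))"
proof (rule step_conf)
  have *: "(word_cells (replicate v True))(int v := 2) = word_cells (replicate (Suc v) True)" for v
    by (rule ext) (auto simp: word_cells_def sym_def nth_Cons' simp del: replicate_Suc)
  show "act (tape_action (P ! q) i (scan (tape_of w i (S i)))) (tape_of w i (S i)) =
      tape_of w i ((S(j := S j + 1)) i)" for i
    using assms by (auto simp: act_idle act_move) 
      (auto simp: act_def tape_of_def *)
qed (use assms in auto)

lemma step_DEC:
  assumes "q < length P" "P ! q = DEC j" "j \<noteq> 1" "S 0 \<le> length w"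
  shows "step (tm_of K P) (conf K w q S) = conf K w (q + 1) (S(j := S j - 1))"
proof (rule step_conf)
  show "act (tape_action (P ! q) i (scan (tape_of w i (S i)))) (tape_of w i (S i)) =
      tape_of w i ((S(j := S j - 1)) i)" for i
    using assms by (auto simp: act_move zero_sym_scan) (auto simp: tape_of_def)
qed (use assms in auto)

lemma step_JZ:
  assumes "q < length P" "P ! q = JZ j l" "j \<noteq> 1" "j < K" "l \<le> length P" "S 0 \<le> length w"
  shows "step (tm_of K P) (conf K w q S) = conf K w (if S j = 0 then l else q + 1) S"
  using assms by (intro step_conf) (auto simp: act_idle zero_sym_scan)

lemma step_JMP:
  assumes "q < length P" "P ! q = JMP l" "l \<le> length P"
  shows "step (tm_of K P) (conf K w q S) = conf K w l S"
  using assms by (intro step_conf) (auto simp: act_idle)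

fun ok :: "nat \<Rightarrow> prog \<Rightarrow> bool" where
  "ok K (Inc i) \<longleftrightarrow> i \<noteq> 0 \<and> i < K"
| "ok K (Dec i) \<longleftrightarrow> i \<noteq> 1 \<and> i < K"
| "ok K (p ;; q) \<longleftrightarrow> ok K p \<and> ok K q"
| "ok K (While i p) \<longleftrightarrow> i \<noteq> 1 \<and> i < K \<and> ok K p"

lemma ok_mono: "ok K p \<Longrightarrow> K \<le> K' \<Longrightarrow> ok K' p"
  by (induction p) auto

text \<open>The code sits between arbitrary \<open>xs\<close> and \<open>ys\<close> because
  subprograms are compiled at absolute addresses inside larger code. The bound on register 0 is
  carried along for the zero tests.\<close>

lemma compile_correct:
  assumes "run p s t s'" "ok K p" "P = xs @ compile (length xs) p @ ys" "s 0 \<le> length w"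
  shows "(step (tm_of K P) ^^ t) (conf K w (length xs) s) =
      conf K w (length xs + length (compile (length xs) p)) s' \<and> s' 0 \<le> length w"
  using assms
proof (induction arbitrary: xs ys rule: run.induct)
  case (Inc i s)
  then show ?case
    using step_INC[of "length xs" P i K w s] by (simp add: fun_upd_def)
next
  case (Dec i s)
  then have "s 0 - 1 \<le> length w"
    by simp
  with Dec show ?case
    using step_DEC[of "length xs" P i s w K] by (simp add: fun_upd_def)
next
  case (Seq p s t s' q t' s'')
  let ?l = "length xs + length (compile (length xs) p)"
  have 1: "(step (tm_of K P) ^^ t) (conf K w (length xs) s) = conf K w ?l s' \<and> s' 0 \<le> length w"
    using Seq.prems by (intro Seq.IH(1)[of xs "compile ?l q @ ys"]) auto
  have 2: "(step (tm_of K P) ^^ t') (conf K w ?l s') = conf K w (?l + length (compile ?l q)) s'' \<and>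
      s'' 0 \<le> length w"
    using Seq.prems 1 Seq.IH(2)[of "xs @ compile (length xs) p" ys] by auto
  show ?case
    using 1 2 by (simp add: add.commute[of t] funpow_add add.assoc)
next
  case (While_zero s i p)
  then show ?case by (auto simp: step_JZ nth_append)
next
  case (While_pos s i p t s' t' s'')
  let ?l = "Suc (length xs)" and ?f = "step (tm_of K P)"
  let ?l' = "?l + length (compile ?l p)"
  have P1: "P = (xs @ [JZ i (?l' + 1)]) @ compile ?l p @ (JMP (length xs) # ys)"
    using While_pos.prems by simp
  have 0: "?f (conf K w (length xs) s) = conf K w ?l s"
    using While_pos.prems While_pos.hyps by (auto simp: step_JZ nth_append)
  have 1: "(?f ^^ t) (conf K w ?l s) = conf K w ?l' s' \<and> s' 0 \<le> length w"
    using While_pos.prems While_pos.IH(1)[of "xs @ [JZ i (?l' + 1)]"] P1 by auto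
  have n: "P ! ?l' = JMP (length xs)" "?l' < length P"
    unfolding P1 by (simp_all add: nth_append)
  have 2: "?f (conf K w ?l' s') = conf K w (length xs) s'"
    using n by (intro step_JMP) auto
  have 3: "(?f ^^ t') (conf K w (length xs) s') = conf K w (?l' + 1) s'' \<and> s'' 0 \<le> length w"
    using While_pos.prems 1 While_pos.IH(2)[of xs ys] by auto
  have "1 + t + 1 + t' = t' + Suc (t + 1)"
    by simp
  also have "(?f ^^ \<dots>) (conf K w (length xs) s) =
      (?f ^^ t') (?f ((?f ^^ t) (?f (conf K w (length xs) s))))"
    by (simp only: funpow_add o_apply funpow.simps(2) funpow_0 One_nat_def)
  finally show ?case
    using 0 1 2 3 by simp
qed

lemma linear_time_constructibleI:
  assumes "\<exists>K. ok K p"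
    and run: "\<And>n. \<exists>t s. t \<le> c * n + c \<and> run p ((\<lambda>_. 0)(0 := n)) t s \<and> s 1 = \<alpha> n"
  shows "linear_time_constructible \<alpha>"
proof -
  obtain K0 where "ok K0 p"
    using assms by blast
  define K where "K = max 2 K0"
  have K: "ok K p" "K \<ge> 2"
    using \<open>ok K0 p\<close> by (auto simp: K_def intro: ok_mono)
  \<comment> \<open>\<open>Mark\<close> is executed once before the program; this is the one step
    beyond \<open>t\<close> below.\<close>
  define P where "P = [Mark] @ compile (length [Mark]) p @ []"
  let ?f = "step (tm_of K P)"
  have "\<exists>t \<le> Suc c * length w + Suc c. halted (tm_of K P) ((?f ^^ t) (init (tm_of K P) w)) \<and>
      output_is ((?f ^^ t) (init (tm_of K P) w)) (replicate (\<alpha> (length w)) True)" for w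
  proof -
    let ?s = "(\<lambda>_. 0)(0 := length w)"
    obtain t s where t: "t \<le> c * length w + c" "run p ?s t s" "s 1 = \<alpha> (length w)"
      using run by blast
    have "map2 act (map (\<lambda>i. tape_action Mark i (map scan (snd (init (tm_of K P) w)) ! i)) [0..<K])
      (snd (init (tm_of K P) w)) = map (\<lambda>i. tape_of w i (?s i)) [0..<K]"
      using K by (intro nth_equalityI)
        (auto simp: init_def tm_of_def nth_Cons' act_def scan_def tape_of_def word_cells_def fun_eq_iff)
    then have 0: "?f (init (tm_of K P) w) = conf K w 1 ?s"
      by (simp add: step_def conf_def tm_of_def init_def P_def)
    have "(?f ^^ t) (conf K w (length [Mark]) ?s) = conf K w (length P) s \<and> s 0 \<le> length w"
      using compile_correct[OF t(2) K(1) P_def, of w] by (simp add: P_def)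
    with 0 have 1: "(?f ^^ (Suc t)) (init (tm_of K P) w) = conf K w (length P) s"
      by (simp add: funpow_swap1)
    have "halted (tm_of K P) (conf K w (length P) s)"
      by (simp add: halted_def conf_def tm_of_def)
    moreover have "output_is (conf K w (length P) s) (replicate (\<alpha> (length w)) True)"
      using K t by (simp add: output_is_def conf_def tape_of_def)
    moreover have "Suc t \<le> Suc c * length w + Suc c"
      using t by simp
    ultimately show ?thesis
      using 1 by metis
  qed
  then show ?thesis
    unfolding linear_time_constructible_def computes_in_time_def
    using wf_tm_of[OF K(2)] by blast
qed

section \<open>Arithmetic functions computed by counter programs\<close>

lemma lg_ge_1: "1 \<le> lg n"
proof (cases "n \<ge> 2")
  case True
  then have "log 2 (real n) > 0" by simp
  then have "\<lceil>log 2 (real n)\<rceil> \<ge> 1" by linarith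
  then have "nat \<lceil>log 2 (real n)\<rceil> \<ge> 1" by linarith
  then show ?thesis using True by (simp only: lg_def if_True)
qed (simp add: lg_def)

text \<open>This adjunction with powers of two replaces the real logarithm. At \<open>j = 0\<close>
  it would fail for \<open>n \<le> 1\<close>, where \<open>lg\<close> is 1 by convention.\<close>

lemma lg_le_iff:
  assumes "j \<ge> 1"
  shows "lg n \<le> j \<longleftrightarrow> n \<le> 2 ^ j"
proof (cases "n \<ge> 2")
  case True
  then have "lg n \<le> j \<longleftrightarrow> log 2 (real n) \<le> real j"
    by (simp add: lg_def nat_le_iff ceiling_le_iff)
  also have "\<dots> \<longleftrightarrow> real n \<le> 2 powr real j"
    using True by (subst log_le_iff) auto
  also have "2 powr real j = real (2 ^ j)"
    by (simp add: powr_realpow)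
  also have "real n \<le> real (2 ^ j) \<longleftrightarrow> n \<le> 2 ^ j"
    by (rule of_nat_le_iff)
  finally show ?thesis .
next
  case False
  have "(2::nat) ^ 1 \<le> 2 ^ j"
    using assms by (intro power_increasing) auto
  then show ?thesis using False assms by (simp add: lg_def)
qed

lemma lg_eqI:
  assumes "x \<ge> 1" "\<And>j. j \<ge> 1 \<Longrightarrow> x \<le> j \<longleftrightarrow> n \<le> 2 ^ j"
  shows "lg n = x"
proof (rule antisym)
  show "lg n \<le> x"
    using assms(2)[of x] assms(1) by (simp add: lg_le_iff)
  show "x \<le> lg n"
    using assms(2)[of "lg n"] lg_le_iff[of "lg n" n] lg_ge_1 by simp
qed

section \<open>Bit length, iterated logarithm and integer square root by elementary
  recursions\<close>

fun bit_length :: "nat \<Rightarrow> nat" where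
  "bit_length n = (if n = 0 then 0 else Suc (bit_length (n div 2)))"

declare bit_length.simps [simp del]

lemma bit_length_le_iff: "bit_length n \<le> j \<longleftrightarrow> n < 2 ^ j"
proof (induction n arbitrary: j rule: bit_length.induct)
  case (1 n)
  show ?case
  proof (cases j)
    case (Suc i)
    then show ?thesis
      using 1[of i] by (subst bit_length.simps) auto
  qed (subst bit_length.simps, auto)
qed

text \<open>Rounding up for \<open>n\<close> is rounding down for \<open>n - 1\<close>:
  \<open>n \<le> 2 * 2 ^ i\<close> means \<open>n - 1 < 2 * 2 ^ i\<close>. This reduces
  \<open>lg\<close> to repeated halving, which counters can do.\<close>

lemma lg_eq_bit_length: "lg n = Suc (bit_length ((n - 1) div 2))"
proof (rule lg_eqI)
  fix j :: nat assume "j \<ge> 1"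
  then obtain i where "j = Suc i" by (cases j) auto
  moreover have "(n - 1) div 2 < 2 ^ i \<longleftrightarrow> n - 1 < 2 * 2 ^ i"
    by auto
  moreover have "n - 1 < 2 * 2 ^ i \<longleftrightarrow> n \<le> 2 * 2 ^ i"
    by (cases n) auto
  ultimately show "Suc (bit_length ((n - 1) div 2)) \<le> j \<longleftrightarrow> n \<le> 2 ^ j"
    by (simp add: bit_length_le_iff)
qed simp

text \<open>Besides a linear bound, this gives the geometric decrease that makes iterating
  \<open>lg\<close> affordable on counters.\<close>

lemma lg_le_half: "lg n \<le> Suc ((n - 1) div 2)"
proof -
  have "bit_length ((n - 1) div 2) \<le> (n - 1) div 2"
    by (simp add: bit_length_le_iff)
  then show ?thesis
    by (simp add: lg_eq_bit_length)
qed

text \<open>Unlike \<open>lgstar\<close>, which has \<open>lgstar 0 = 1\<close> and \<open>lgstar 1 = 0\<close>, this is monotone; the two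
  differ at \<open>0\<close> only.\<close>

function lstar :: "nat \<Rightarrow> nat" where
  "lstar n = (if n \<le> 1 then 0 else Suc (lstar (lg n)))"
  by auto
termination
proof (relation "measure id")
  fix n :: nat assume "\<not> n \<le> 1"
  then have "n \<le> 2 ^ (n - 1)"
    using less_exp[of "n - 1"] by linarith
  with \<open>\<not> n \<le> 1\<close> have "lg n \<le> n - 1"
    by (subst lg_le_iff) auto
  with \<open>\<not> n \<le> 1\<close> show "(lg n, n) \<in> measure id"
    by simp
qed simp

declare lstar.simps [simp del]

text \<open>Subtracting successive odd numbers from \<open>p\<close>. The test \<open>d = 0\<close> only serves termination.\<close>

fun ceil_sqrt_aux :: "nat \<Rightarrow> nat \<Rightarrow> nat" where
  "ceil_sqrt_aux p d = (if p = 0 \<or> d = 0 then 0 else Suc (ceil_sqrt_aux (p - d) (d + 2)))"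

declare ceil_sqrt_aux.simps [simp del]

definition ceil_sqrt :: "nat \<Rightarrow> nat" where
  "ceil_sqrt p = ceil_sqrt_aux p 1"

text \<open>The subtrahend \<open>2 * r + 1\<close> is the difference between the squares of
  \<open>r + 1\<close> and \<open>r\<close>, so \<open>p + r ^ 2\<close> is unchanged by a round
  whose subtraction is not truncated.\<close>

lemma ceil_sqrt_aux_le_iff:
  "ceil_sqrt_aux p (2 * r + 1) \<le> s \<longleftrightarrow> p + r ^ 2 \<le> (r + s) ^ 2"
proof (induction s arbitrary: p r)
  case 0
  then show ?case
    by (subst ceil_sqrt_aux.simps) auto
next
  case (Suc s)
  have "(r + Suc s)^2 = (Suc r + s)^2" "(Suc r)^2 = r^2 + (2 * r + 1)"
    by (simp_all add: power2_eq_square algebra_simps)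
  moreover have "(Suc r)^2 \<le> (Suc r + s)^2"
    by (intro power_mono) auto
  ultimately show ?case
    using Suc[of "p - (2 * r + 1)" "Suc r"] by (subst ceil_sqrt_aux.simps) auto
qed

lemma ceil_sqrt_le_iff: "ceil_sqrt p \<le> s \<longleftrightarrow> p \<le> s ^ 2"
  using ceil_sqrt_aux_le_iff[of p 0 s] by (simp add: ceil_sqrt_def)

section \<open>Upper bounds on running times and the basic counter programs\<close>

definition runs :: "prog \<Rightarrow> (nat \<Rightarrow> nat) \<Rightarrow> nat \<Rightarrow> (nat \<Rightarrow> nat) \<Rightarrow> bool" where
  "runs p s T s' \<longleftrightarrow> (\<exists>t\<le>T. run p s t s')"

lemma runs_Inc: "runs (Inc i) s 1 (s(i := s i + 1))"
  using run.Inc by (auto simp: runs_def)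

lemma runs_Dec: "runs (Dec i) s 1 (s(i := s i - 1))"
  using run.Dec by (auto simp: runs_def)

lemma runs_Seq: "runs p s T s' \<Longrightarrow> runs q s' T' s'' \<Longrightarrow> runs (p ;; q) s (T + T') s''"
  unfolding runs_def using run.Seq add_mono by metis

lemma runs_weaken: "runs p s T s' \<Longrightarrow> T \<le> T' \<Longrightarrow> s' = s'' \<Longrightarrow> runs p s T' s''"
  unfolding runs_def using le_trans by blast

text \<open>\<open>F s\<close> is the state in which the loop ends when started in \<open>s\<close>, so the body, whose effect is
  \<open>G\<close>, must leave it unchanged.\<close>

lemma runs_While:
  assumes "I s"
    and C: "\<And>s. 1 \<le> C s"
    and exit: "\<And>s. I s \<Longrightarrow> s i = 0 \<Longrightarrow> F s = s"
    and body: "\<And>s. I s \<Longrightarrow> s i \<noteq> 0 \<Longrightarrow> runs p s (T s) (G s)"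
    and dec: "\<And>s. I s \<Longrightarrow> s i \<noteq> 0 \<Longrightarrow> G s i < s i"
    and inv: "\<And>s. I s \<Longrightarrow> s i \<noteq> 0 \<Longrightarrow> I (G s)"
    and F: "\<And>s. I s \<Longrightarrow> s i \<noteq> 0 \<Longrightarrow> F (G s) = F s"
    and cost: "\<And>s. I s \<Longrightarrow> s i \<noteq> 0 \<Longrightarrow> T s + C (G s) + 2 \<le> C s"
  shows "runs (While i p) s (C s) (F s)"
  using \<open>I s\<close>
proof (induction "s i" arbitrary: s rule: less_induct)
  case less
  show ?case
  proof (cases "s i = 0")
    case True
    then show ?thesis
      using run.While_zero[of s i p] C[of s] exit[OF \<open>I s\<close>] unfolding runs_def by auto
  next
    case False
    obtain t where t: "t \<le> T s" "run p s t (G s)"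
      using body[OF \<open>I s\<close> False] by (auto simp: runs_def)
    obtain t' where t': "t' \<le> C (G s)" "run (While i p) (G s) t' (F s)"
      using less.hyps[of "G s", OF dec inv] less.prems False F[of s] by (auto simp: runs_def)
    have "run (While i p) s (1 + t + 1 + t') (F s)"
      using False t t' by (intro run.While_pos) auto
    then show ?thesis
      using t t' cost[OF \<open>I s\<close> False] unfolding runs_def by (intro exI[of _ "1 + t + 1 + t'"]) auto
  qed
qed

lemmas runs_basic = runs_Seq runs_Inc runs_Dec

definition clear :: "nat \<Rightarrow> prog" where
  "clear a = While a (Dec a)"

lemma runs_clear: "runs (clear a) s (3 * s a + 1) (s(a := 0))"
  unfolding clear_def
  by (rule runs_While[where I = "\<lambda>_. True" and T = "\<lambda>_. 1" and G = "\<lambda>s. s(a := s a - 1)"])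
    (auto simp: runs_Dec[simplified])

definition move :: "nat \<Rightarrow> nat \<Rightarrow> prog" where
  "move a r = While a (Dec a ;; Inc r)"

lemma runs_move:
  assumes "a \<noteq> r"
  shows "runs (move a r) s (4 * s a + 1) (s(r := s r + s a, a := 0))"
  unfolding move_def
proof (rule runs_While[where I = "\<lambda>_. True" and T = "\<lambda>_. 2"
      and G = "\<lambda>s. s(a := s a - 1, r := s r + 1)"], goal_cases)
  case (4 s)
  show ?case
    by (rule runs_weaken, (rule runs_basic)+) (use assms in auto)
qed (use assms in auto)

text \<open>The loop destroys \<open>a\<close>, so \<open>t\<close> collects a copy that is moved
  back; likewise in \<open>sub\<close>.\<close>

definition add :: "nat \<Rightarrow> nat \<Rightarrow> nat \<Rightarrow> prog" where
  "add a r t = While a (Dec a ;; Inc r ;; Inc t) ;; move t a"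

lemma runs_add:
  assumes "distinct [a, r, t]" "s t = 0"
  shows "runs (add a r t) s (9 * s a + 2) (s(r := s r + s a))"
proof -
  have "runs (While a (Dec a ;; Inc r ;; Inc t)) s (5 * s a + 1)
      (s(r := s r + s a, t := s t + s a, a := 0))"
  proof (rule runs_While[where I = "\<lambda>_. True" and T = "\<lambda>_. 3"
        and G = "\<lambda>s. s(a := s a - 1, r := s r + 1, t := s t + 1)"], goal_cases)
    case (4 s)
    show ?case
      by (rule runs_weaken, (rule runs_basic)+) (use assms in auto)
  qed (use assms in auto)
  from runs_Seq[OF this runs_move] show ?thesis
    unfolding add_def by (rule runs_weaken) (use assms in auto)
qed

definition sub :: "nat \<Rightarrow> nat \<Rightarrow> nat \<Rightarrow> prog" where
  "sub a r t = While a (Dec a ;; Dec r ;; Inc t) ;; move t a"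

lemma runs_sub:
  assumes "distinct [a, r, t]" "s t = 0"
  shows "runs (sub a r t) s (9 * s a + 2) (s(r := s r - s a))"
proof -
  have "runs (While a (Dec a ;; Dec r ;; Inc t)) s (5 * s a + 1)
      (s(r := s r - s a, t := s t + s a, a := 0))"
  proof (rule runs_While[where I = "\<lambda>_. True" and T = "\<lambda>_. 3"
        and G = "\<lambda>s. s(a := s a - 1, r := s r - 1, t := s t + 1)"], goal_cases)
    case (4 s)
    show ?case
      by (rule runs_weaken, (rule runs_basic)+) (use assms in auto)
  qed (use assms in auto)
  from runs_Seq[OF this runs_move] show ?thesis
    unfolding sub_def by (rule runs_weaken) (use assms in auto)
qed

definition halve :: "nat \<Rightarrow> nat \<Rightarrow> prog" where
  "halve a r = While a (Dec a ;; Dec a ;; Inc r)"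

text \<open>The quotient is rounded up: on an odd value the second \<open>Dec\<close> of the last
  pass is truncated, but \<open>r\<close> is still incremented.\<close>

lemma runs_halve:
  assumes "a \<noteq> r"
  shows "runs (halve a r) s (5 * s a + 1) (s(r := s r + (s a + 1) div 2, a := 0))"
  unfolding halve_def
proof (rule runs_While[where I = "\<lambda>_. True" and T = "\<lambda>_. 3"
      and G = "\<lambda>s. s(a := s a - 2, r := s r + 1)"], goal_cases)
  case (4 s)
  show ?case
    by (rule runs_weaken, (rule runs_basic)+) (use assms in \<open>auto simp: numeral_2_eq_2\<close>)
next
  case (7 s)
  then obtain k where "s a = Suc k" by (cases "s a") auto
  then show ?case using assms by (cases k) auto
qed (use assms in auto)

definition double :: "nat \<Rightarrow> nat \<Rightarrow> prog" where
  "double a t = While a (Dec a ;; Inc t ;; Inc t) ;; move t a"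

lemma runs_double:
  assumes "a \<noteq> t" "s t = 0"
  shows "runs (double a t) s (13 * s a + 2) (s(a := 2 * s a))"
proof -
  have "runs (While a (Dec a ;; Inc t ;; Inc t)) s (5 * s a + 1) (s(t := s t + 2 * s a, a := 0))"
  proof (rule runs_While[where I = "\<lambda>_. True" and T = "\<lambda>_. 3"
        and G = "\<lambda>s. s(a := s a - 1, t := s t + 2)"], goal_cases)
    case (4 s)
    show ?case
      by (rule runs_weaken, (rule runs_basic)+) (use assms in auto)
  qed (use assms in \<open>auto simp: fun_eq_iff\<close>)
  from runs_Seq[OF this runs_move] show ?thesis
    unfolding double_def by (rule runs_weaken) (use assms in auto)
qed

text \<open>Since \<open>halve\<close> rounds up, one \<open>Dec\<close> before it yields halving
  rounded down. The two initial \<open>Dec\<close> serve this correction and the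
  \<open>n - 1\<close> in \<open>lg_eq_bit_length\<close>.\<close>

definition log_prog :: "nat \<Rightarrow> nat \<Rightarrow> nat \<Rightarrow> prog" where
  "log_prog a r t = Dec a ;; Dec a ;; halve a t ;; move t a ;; Inc r ;;
     While a (Dec a ;; halve a t ;; move t a ;; Inc r)"

lemma runs_log_prog:
  assumes "distinct [a, r, t]" "s t = 0"
  shows "runs (log_prog a r t) s (35 * s a + 10) (s(r := s r + lg (s a), a := 0))"
proof -
  \<comment> \<open>A pass costs \<open>7 * s a + 4\<close> and halves \<open>s a\<close>; the
    coefficient 26 covers 7, then 13 for the remaining passes, and the constants, because
    \<open>s a\<close> is at least 1.\<close>
  have loop: "runs (While a (Dec a ;; halve a t ;; move t a ;; Inc r)) s (26 * s a + 1)
      (s(r := s r + bit_length (s a), a := 0))" if "s t = 0" for s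
  proof (rule runs_While[where I = "\<lambda>s. s t = 0" and T = "\<lambda>s. 7 * s a + 4"
        and G = "\<lambda>s. s(a := s a div 2, r := s r + 1)"], goal_cases)
    case (4 s)
    show ?case
      by (rule runs_weaken, ((rule runs_basic runs_halve runs_move) | (use assms 4 in \<open>simp; fail\<close>))+) (use assms 4 in auto)
  next
    case (7 s)
    then show ?case using assms bit_length.simps[of "s a"] by auto
  qed (use assms that in \<open>auto simp: bit_length.simps[of 0]\<close>)
  have half: "Suc (s a - Suc (Suc 0)) div 2 = (s a - Suc 0) div 2"
    by (cases "s a"; cases "s a - 1") auto
  show ?thesis
    unfolding log_prog_def
    by (rule runs_weaken, ((rule runs_basic runs_halve runs_move loop) | (use assms in \<open>simp; fail\<close>))+)
      (use assms in \<open>auto simp: lg_eq_bit_length fun_eq_iff half\<close>)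
qed

definition mult :: "nat \<Rightarrow> nat \<Rightarrow> nat \<Rightarrow> nat \<Rightarrow> prog" where
  "mult a b r t = While a (Dec a ;; add b r t)"

lemma runs_mult:
  assumes "distinct [a, b, r, t]" "s t = 0"
  shows "runs (mult a b r t) s (s a * (9 * s b + 5) + 1) (s(r := s r + s a * s b, a := 0))"
  unfolding mult_def
proof (rule runs_While[where I = "\<lambda>s. s t = 0" and T = "\<lambda>s. 9 * s b + 3"
        and G = "\<lambda>s. s(a := s a - 1, r := s r + s b)"], goal_cases)
  case (4 s)
  show ?case
    by (rule runs_weaken, ((rule runs_basic runs_add) | (use assms 4 in \<open>simp; fail\<close>))+)
next
  case (7 s)
  then show ?case using assms by (cases "s a") auto
next
  case (8 s)
  then show ?case using assms by (cases "s a") auto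
qed (use assms in auto)

definition sqrt_prog :: "nat \<Rightarrow> nat \<Rightarrow> nat \<Rightarrow> nat \<Rightarrow> prog" where
  "sqrt_prog a r d t = Inc d ;; While a (sub d a t ;; Inc d ;; Inc d ;; Inc r) ;; clear d"

lemma runs_sqrt_prog:
  assumes "distinct [a, r, d, t]" "s t = 0" "s d = 0"
  shows "runs (sqrt_prog a r d t) s (40 * s a + 30) (s(r := s r + ceil_sqrt (s a), a := 0))"
proof -
  let ?q = "\<lambda>s. ceil_sqrt_aux (s a) (s d)"
  \<comment> \<open>Lowering \<open>s a\<close> by \<open>d\<close> pays for a pass. The last pass
    may lower it by less, which the summand \<open>9 * s d\<close> covers; once
    \<open>s a = 0\<close> this must not be charged again, hence the case distinction.\<close>
  have loop: "runs (While a (sub d a t ;; Inc d ;; Inc d ;; Inc r)) s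
      (if s a = 0 then 1 else 34 * s a + 9 * s d + 8)
      (s(r := s r + ?q s, d := s d + 2 * ?q s, a := 0))" if "s t = 0" "s d \<noteq> 0" for s
  proof (rule runs_While[where I = "\<lambda>s. s t = 0 \<and> s d \<noteq> 0" and T = "\<lambda>s. 9 * s d + 5"
        and G = "\<lambda>s. s(a := s a - s d, d := s d + 2, r := s r + 1)"], goal_cases)
    case (4 s)
    show ?case
      by (rule runs_weaken, ((rule runs_basic runs_sub) | (use assms 4 in \<open>simp; fail\<close>))+)
  next
    case (7 s)
    then show ?case using assms ceil_sqrt_aux.simps[of "s a" "s d"] by auto
  qed (use assms that in \<open>auto simp: ceil_sqrt_aux.simps[of 0]\<close>)
  have "ceil_sqrt_aux (s a) (Suc 0) \<le> s a"
    using ceil_sqrt_le_iff[of "s a" "s a"] by (simp add: ceil_sqrt_def power2_eq_square)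
  then show ?thesis
    unfolding sqrt_prog_def
    by (intro runs_weaken[OF runs_Seq[OF runs_Inc runs_Seq[OF loop runs_clear]]])
      (use assms in \<open>auto simp: ceil_sqrt_def fun_eq_iff\<close>)
qed

definition exp_prog :: "nat \<Rightarrow> nat \<Rightarrow> nat \<Rightarrow> prog" where
  "exp_prog a r t = Inc r ;; While a (Dec a ;; double r t)"

text \<open>Each doubling costs time proportional to the current value, so the total is a geometric
  series of the order of the result.\<close>

lemma runs_exp_prog:
  assumes "distinct [a, r, t]" "s t = 0" "s r = 0"
  shows "runs (exp_prog a r t) s (18 * 2 ^ s a + 2) (s(r := 2 ^ s a, a := 0))"
proof -
  have loop: "runs (While a (Dec a ;; double r t)) s (18 * s r * (2 ^ s a - 1) + 1)
      (s(r := s r * 2 ^ s a, a := 0))" if "s t = 0" "s r \<noteq> 0" for s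
  proof (rule runs_While[where I = "\<lambda>s. s t = 0 \<and> s r \<noteq> 0" and T = "\<lambda>s. 13 * s r + 3"
        and G = "\<lambda>s. s(a := s a - 1, r := 2 * s r)"], goal_cases)
    case (4 s)
    show ?case
      by (rule runs_weaken, ((rule runs_basic runs_double) | (use assms 4 in \<open>simp; fail\<close>))+)
  next
    case (7 s)
    then show ?case using assms by (cases "s a") auto
  next
    case (8 s)
    then obtain k where k: "s a = Suc k" by (cases "s a") auto
    obtain m where m: "(2::nat) ^ k = Suc m" by (metis gr0_implies_Suc pos2 zero_less_power)
    show ?case using assms 8 k m by (auto simp: algebra_simps)
  qed (use assms that in auto)
  show ?thesis
    unfolding exp_prog_def
    by (intro runs_weaken[OF runs_Seq[OF runs_Inc loop]]) (use assms in auto)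
qed

section \<open>Functions computable in linear time by counter programs\<close>

lemma two_pow_lg_le: "2 ^ lg n \<le> 2 * n + 2"
proof (cases "lg n = 1")
  case False
  then have "\<not> lg n \<le> lg n - 1" and l: "lg n - 1 \<ge> 1"
    using lg_ge_1[of n] by auto
  then have "2 ^ (lg n - 1) < n"
    by (simp only: lg_le_iff[OF l] not_le)
  moreover have "(2::nat) ^ lg n = 2 * 2 ^ (lg n - 1)"
    using lg_ge_1[of n] by (cases "lg n") auto
  ultimately show ?thesis by simp
qed simp

text \<open>Applied to the larger of two logarithms, this makes the time for multiplying them linear
  in the original numbers.\<close>

lemma square_le_two_pow: "n * n \<le> 2 * 2 ^ n" for n :: nat
proof (induction n)
  case (Suc n)
  show ?case
  proof (cases "n \<ge> 3")
    case True
    then have "2 * n + 1 \<le> n * n"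
      using mult_le_mono1[OF True, of n] by linarith
    then show ?thesis using Suc by simp
  next
    case False
    then have "n \<in> {0, 1, 2}" by auto
    then show ?thesis by auto
  qed
qed simp

definition wf_prog :: "prog \<Rightarrow> bool" where
  "wf_prog p \<longleftrightarrow> (\<exists>K. ok K p)"

lemma wf_prog_simps [simp]:
  "wf_prog (Inc i) \<longleftrightarrow> i \<noteq> 0"
  "wf_prog (Dec i) \<longleftrightarrow> i \<noteq> 1"
  "wf_prog (p ;; q) \<longleftrightarrow> wf_prog p \<and> wf_prog q"
  "wf_prog (While i p) \<longleftrightarrow> i \<noteq> 1 \<and> wf_prog p"
proof -
  show "wf_prog (p ;; q) \<longleftrightarrow> wf_prog p \<and> wf_prog q"
    unfolding wf_prog_def by (auto intro: ok_mono[OF _ max.cobounded1] ok_mono[OF _ max.cobounded2])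
  show "wf_prog (While i p) \<longleftrightarrow> i \<noteq> 1 \<and> wf_prog p"
  proof
    assume "i \<noteq> 1 \<and> wf_prog p"
    then obtain K where K: "ok K p" "i \<noteq> 1"
      unfolding wf_prog_def by blast
    then have "ok (max K (Suc i)) (While i p)"
      by (simp add: ok_mono[OF K(1) max.cobounded1] less_max_iff_disj)
    then show "wf_prog (While i p)"
      unfolding wf_prog_def by blast
  qed (auto simp: wf_prog_def)
qed (auto simp: wf_prog_def)

lemma wf_prog_programs [simp]:
  assumes "a \<ge> 2" "b \<ge> 2" "r \<ge> 2" "t \<ge> 2"
  shows "wf_prog (clear a)" "wf_prog (move a r)" "wf_prog (add a r t)"
    "wf_prog (halve a r)" "wf_prog (log_prog a r t)" "wf_prog (mult a b r t)"
    "wf_prog (sqrt_prog a r b t)" "wf_prog (exp_prog a r t)"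
  using assms
  by (auto simp: clear_def move_def add_def sub_def halve_def double_def log_prog_def mult_def
      sqrt_prog_def exp_prog_def)

text \<open>The program \<open>p a r b\<close> reads its argument from register \<open>a\<close>, writes the result to \<open>r\<close>, and uses
  the registers from \<open>b\<close> on as scratch space, which it finds and leaves empty.\<close>

definition computes_linear ::
    "(nat \<Rightarrow> nat \<Rightarrow> nat \<Rightarrow> prog) \<Rightarrow> nat \<Rightarrow> (nat \<Rightarrow> nat) \<Rightarrow> bool" where
  "computes_linear p c f \<longleftrightarrow> (\<forall>a r b. 2 \<le> a \<longrightarrow> 2 \<le> r \<longrightarrow> a < b \<longrightarrow> r < b \<longrightarrow> a \<noteq> r \<longrightarrow>
     wf_prog (p a r b) \<and>
     (\<forall>s. (\<forall>i\<ge>b. s i = 0) \<longrightarrow> s r = 0 \<longrightarrow> runs (p a r b) s (c * s a + c) (s(r := f (s a)))))"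

definition counter_linear :: "(nat \<Rightarrow> nat) \<Rightarrow> bool" where
  "counter_linear f \<longleftrightarrow> (\<exists>p c. computes_linear p c f)"

lemma counter_linearI:
  assumes "\<And>a r b. \<lbrakk>2 \<le> a; 2 \<le> r; a < b; r < b; a \<noteq> r\<rbrakk> \<Longrightarrow> wf_prog (p a r b)"
    and "\<And>a r b s. \<lbrakk>2 \<le> a; 2 \<le> r; a < b; r < b; a \<noteq> r; \<forall>i\<ge>b. s i = 0; s r = 0\<rbrakk> \<Longrightarrow>
      runs (p a r b) s (T (s a)) (s(r := f (s a)))"
    and "\<And>n. T n \<le> c * n + c"
  shows "counter_linear f"
  unfolding counter_linear_def computes_linear_def
  by (intro exI[of _ p] exI[of _ c]) (use assms in \<open>blast intro: runs_weaken\<close>)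

lemma computes_linear_wf:
  "computes_linear p c f \<Longrightarrow> 2 \<le> a \<Longrightarrow> 2 \<le> r \<Longrightarrow> a < b \<Longrightarrow> r < b \<Longrightarrow> a \<noteq> r \<Longrightarrow> wf_prog (p a r b)"
  by (auto simp: computes_linear_def)

lemma computes_linear_runs:
  "computes_linear p c f \<Longrightarrow> 2 \<le> a \<Longrightarrow> 2 \<le> r \<Longrightarrow> a < b \<Longrightarrow> r < b \<Longrightarrow> a \<noteq> r \<Longrightarrow>
     \<forall>i\<ge>b. s i = 0 \<Longrightarrow> s r = 0 \<Longrightarrow> runs (p a r b) s (c * s a + c) (s(r := f (s a)))"
  by (auto simp: computes_linear_def)

lemma counter_linear_two: "counter_linear (\<lambda>n. 2)"
proof (rule counter_linearI[where p = "\<lambda>a r b. Inc r ;; Inc r" and T = "\<lambda>_. 2" and c = 2], goal_cases)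
  case (2 a r b s)
  show ?case
    by (rule runs_weaken, (rule runs_basic)+) (use 2 in \<open>auto simp: numeral_2_eq_2\<close>)
qed auto

lemma counter_linear_half: "counter_linear (\<lambda>n. (n + 1) div 2 + 2)"
proof (rule counter_linearI[where p = "\<lambda>a r b. add a b (b + 1) ;; halve b r ;; Inc r ;; Inc r"
      and T = "\<lambda>n. 14 * n + 5" and c = 14], goal_cases)
  case (2 a r b s)
  show ?case
    by (rule runs_weaken, ((rule runs_basic runs_add runs_halve) | (use 2 in \<open>simp; fail\<close>))+)
      (use 2 in auto)
qed auto

lemma counter_linear_lg: "counter_linear lg"
proof (rule counter_linearI[where p = "\<lambda>a r b. add a b (b + 1) ;; log_prog b r (b + 1)"
      and T = "\<lambda>n. 44 * n + 12" and c = 44], goal_cases)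
  case (2 a r b s)
  show ?case
    by (rule runs_weaken, ((rule runs_basic runs_add runs_log_prog) | (use 2 in \<open>simp; fail\<close>))+)
      (use 2 in \<open>auto simp: fun_eq_iff\<close>)
qed auto

lemma counter_linear_plus:
  assumes "counter_linear f"
  shows "counter_linear (\<lambda>n. f n + 1)"
proof -
  obtain p c where p: "computes_linear p c f"
    using assms by (auto simp: counter_linear_def)
  show ?thesis
  proof (rule counter_linearI[where p = "\<lambda>a r b. p a r b ;; Inc r" and T = "\<lambda>n. c * n + c + 1"
        and c = "Suc c"], goal_cases)
    case (1 a r b)
    then show ?case by (auto intro: computes_linear_wf[OF p])
  next
    case (2 a r b s)
    from runs_Seq[OF computes_linear_runs[OF p this] runs_Inc] show ?case
      by (rule runs_weaken) auto
  qed auto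
qed

lemma counter_linear_comp:
  assumes "counter_linear f" "counter_linear g" and d: "\<And>n. f n \<le> d * n + d"
  shows "counter_linear (\<lambda>n. g (f n))"
proof -
  obtain p c where p: "computes_linear p c f"
    using assms by (auto simp: counter_linear_def)
  obtain p' c' where p': "computes_linear p' c' g"
    using assms by (auto simp: counter_linear_def)
  let ?T = "\<lambda>n. c * n + c + (c' * f n + c' + (3 * f n + 1))"
  show ?thesis
  proof (rule counter_linearI[where p = "\<lambda>a r b. p a b (b + 1) ;; p' b r (b + 1) ;; clear b"
        and T = ?T and c = "c + (c' * d + c' + 3 * d + 1)"], goal_cases)
    case (1 a r b)
    then show ?case by (auto intro: computes_linear_wf[OF p] computes_linear_wf[OF p'])
  next
    case (2 a r b s)
    have 1: "runs (p a b (b + 1)) s (c * s a + c) (s(b := f (s a)))"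
      using 2 by (intro computes_linear_runs[OF p]) auto
    have "runs (p' b r (b + 1)) (s(b := f (s a))) (c' * (s(b := f (s a))) b + c')
        ((s(b := f (s a)))(r := g ((s(b := f (s a))) b)))"
      using 2 by (intro computes_linear_runs[OF p']) auto
    from runs_Seq[OF 1 runs_Seq[OF this runs_clear]] show ?case
      by (rule runs_weaken) (use 2 in auto)
  next
    case (3 n)
    have "c' * f n \<le> c' * (d * n + d)" "3 * f n \<le> 3 * (d * n + d)"
      using d[of n] by simp_all
    then show ?case by (simp add: algebra_simps)
  qed
qed

lemma counter_linear_lg_iter: "counter_linear (\<lambda>n. (lg ^^ Suc m) n)"
proof (induction m)
  case (Suc m)
  have "(lg ^^ Suc m) n \<le> 1 * n + 1" for n
  proof (induction m)
    case 0
    show ?case using lg_le_half[of n] by simp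
  next
    case (Suc m)
    then show ?case using lg_le_half[of "(lg ^^ Suc m) n"] lg_ge_1 by (simp del: funpow.simps add: funpow.simps(2)[of "Suc m"])
  qed
  from counter_linear_comp[OF Suc counter_linear_lg this] show ?case by simp
qed (simp add: counter_linear_lg)

lemma counter_linear_lstar: "counter_linear lstar"
proof -
  \<comment> \<open>Register \<open>g\<close> holds the current value minus 1, because the iteration
    stops at 1 while counters can only be tested for 0. By \<open>lg_le_half\<close> each pass at
    least halves \<open>g\<close>, whence the linear cost.\<close>
  define body where "body g r = Inc g ;; log_prog g (g + 1) (g + 2) ;; move (g + 1) g ;; Dec g ;; Inc r" for g r
  have loop: "runs (While g (body g r)) s (300 * s g + 1) (s(r := s r + lstar (s g + 1), g := 0))"
    if "r < g" "s (g + 1) = 0 \<and> s (g + 2) = 0" for g r s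
  proof (rule runs_While[where I = "\<lambda>s. s (g + 1) = 0 \<and> s (g + 2) = 0" and T = "\<lambda>s. 39 * s g + 60"
        and G = "\<lambda>s. s(g := lg (s g + 1) - 1, r := s r + 1)"], goal_cases)
    case (4 s)
    have "4 * lg (Suc (s g)) \<le> 4 * s g + 4"
      using lg_le_half[of "s g + 1"] 4 by simp
    then show ?case
      unfolding body_def
      by - (rule runs_weaken, ((rule runs_basic runs_move runs_log_prog) | (use that 4 in \<open>simp; fail\<close>))+,
        use that 4 in \<open>auto simp: fun_eq_iff\<close>)
  next
    case (5 s)
    then show ?case using lg_le_half[of "s g + 1"] that by simp
  next
    case (7 s)
    then show ?case using lstar.simps[of "s g + 1"] lg_ge_1[of "s g + 1"] that by (auto simp: fun_eq_iff)
  next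
    case (8 s)
    then show ?case using lg_le_half[of "s g + 1"] that by simp
  qed (use that in \<open>auto simp: lstar.simps[of "Suc 0"] fun_eq_iff\<close>)
  show ?thesis
  proof (rule counter_linearI[where p = "\<lambda>a r b. add a b (b + 1) ;; Dec b ;; While b (body b r)"
      and T = "\<lambda>n. 400 * n + 10" and c = 400], goal_cases)
    case (1 a r b)
    then show ?case by (auto simp: body_def)
  next
    case (2 a r b s)
    have "lstar (s a) = lstar (s a - 1 + 1)"
      by (cases "s a") (auto simp: lstar.simps[of 0] lstar.simps[of "Suc 0"])
    then show ?case
      by - (rule runs_weaken, ((rule runs_basic runs_add loop) | (use 2 in \<open>simp; fail\<close>))+,
        use 2 in \<open>auto simp: fun_eq_iff\<close>)
  qed auto
qed

definition midpoint :: "nat \<Rightarrow> nat \<Rightarrow> nat" where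
  "midpoint x y = 2 ^ ceil_sqrt (lg x * lg y)"

text \<open>With \<open>m\<close> the larger logarithm, the product of the logarithms is at most
  \<open>m * m \<le> 2 * 2 ^ m\<close>, the result is at most \<open>2 ^ m\<close>, and
  \<open>2 ^ m\<close> is linear in \<open>f n + g n\<close>. So every stage takes linear
  time.\<close>

lemma counter_linear_midpoint:
  assumes "counter_linear f" "counter_linear g" and d: "\<And>n. f n \<le> d * n + d" "\<And>n. g n \<le> d * n + d"
  shows "counter_linear (\<lambda>n. midpoint (f n) (g n))"
proof -
  obtain p c where p: "computes_linear p c f"
    using assms by (auto simp: counter_linear_def)
  obtain p' c' where p': "computes_linear p' c' g"
    using assms by (auto simp: counter_linear_def)
  define T where "T n = (c * n + c) + ((c' * n + c') + ((35 * f n + 10) + ((35 * g n + 10) +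
     ((lg (f n) * (9 * lg (g n) + 5) + 1) + ((3 * lg (g n) + 1) + ((40 * (lg (f n) * lg (g n)) + 30) +
     (18 * midpoint (f n) (g n) + 2)))))))" for n
  show ?thesis
  proof (rule counter_linearI[where p = "\<lambda>a r b. p a b (b + 1) ;; p' a (b + 1) (b + 2) ;;
          log_prog b (b + 2) (b + 4) ;; log_prog (b + 1) (b + 3) (b + 4) ;;
          mult (b + 2) (b + 3) b (b + 4) ;; clear (b + 3) ;; sqrt_prog b (b + 1) (b + 2) (b + 3) ;;
          exp_prog (b + 1) r (b + 2)"
        and T = T and c = "c + c' + 2000 * d + 3000"], goal_cases)
    case (1 a r b)
    then show ?case by (auto intro: computes_linear_wf[OF p] computes_linear_wf[OF p'])
  next
    case (2 a r b s)
    let ?x = "f (s a)" and ?y = "g (s a)"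
    define s1 where "s1 = s(b := ?x)"
    define s2 where "s2 = s1(b + 1 := ?y)"
    define s3 where "s3 = s2(b + 2 := lg ?x, b := 0)"
    define s4 where "s4 = s3(b + 3 := lg ?y, b + 1 := 0)"
    define s5 where "s5 = s4(b := lg ?x * lg ?y, b + 2 := 0)"
    define s6 where "s6 = s5(b + 3 := 0)"
    define s7 where "s7 = s6(b + 1 := ceil_sqrt (lg ?x * lg ?y), b := 0)"
    define s8 where "s8 = s7(r := midpoint ?x ?y, b + 1 := 0)"
    have "runs (p a b (b + 1)) s (c * s a + c) s1"
      using 2 unfolding s1_def by (intro computes_linear_runs[OF p]) auto
    moreover have "runs (p' a (b + 1) (b + 2)) s1 (c' * s a + c') s2"
      using 2 computes_linear_runs[OF p', of a "b + 1" "b + 2" s1] unfolding s2_def by (simp add: s1_def)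
    moreover have "runs (log_prog b (b + 2) (b + 4)) s2 (35 * ?x + 10) s3"
      using 2 runs_log_prog[of b "b + 2" "b + 4" s2] unfolding s3_def by (simp add: s2_def s1_def)
    moreover have "runs (log_prog (b + 1) (b + 3) (b + 4)) s3 (35 * ?y + 10) s4"
      using 2 runs_log_prog[of "b + 1" "b + 3" "b + 4" s3] unfolding s4_def
      by (simp add: s3_def s2_def s1_def)
    moreover have "runs (mult (b + 2) (b + 3) b (b + 4)) s4 (lg ?x * (9 * lg ?y + 5) + 1) s5"
      using 2 runs_mult[of "b + 2" "b + 3" b "b + 4" s4] unfolding s5_def
      by (simp add: s4_def s3_def s2_def s1_def)
    moreover have "runs (clear (b + 3)) s5 (3 * lg ?y + 1) s6"
      using runs_clear[of "b + 3" s5] unfolding s6_def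
      by (simp add: s5_def s4_def s3_def s2_def s1_def)
    moreover have "runs (sqrt_prog b (b + 1) (b + 2) (b + 3)) s6 (40 * (lg ?x * lg ?y) + 30) s7"
      using 2 runs_sqrt_prog[of b "b + 1" "b + 2" "b + 3" s6] unfolding s7_def
      by (simp add: s6_def s5_def s4_def s3_def s2_def s1_def)
    moreover have "runs (exp_prog (b + 1) r (b + 2)) s7 (18 * midpoint ?x ?y + 2) s8"
      using 2 runs_exp_prog[of "b + 1" r "b + 2" s7] unfolding s8_def midpoint_def
      by (simp add: s7_def s6_def s5_def s4_def s3_def s2_def s1_def)
    moreover have "s8 = s(r := midpoint ?x ?y)"
      using 2 by (auto simp: s8_def s7_def s6_def s5_def s4_def s3_def s2_def s1_def)
    ultimately show ?case
      unfolding T_def by (blast intro: runs_Seq)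
  next
    case (3 n)
    let ?x = "f n" and ?y = "g n" and ?m = "max (lg (f n)) (lg (g n))"
    have Q: "2 ^ ?m \<le> 2 * (?x + ?y) + 2"
      using two_pow_lg_le[of ?x] two_pow_lg_le[of ?y] by (simp add: max_def)
    have "lg ?x * lg ?y \<le> ?m * ?m"
      by (intro mult_le_mono) auto
    moreover from this have "midpoint ?x ?y \<le> 2 ^ ?m"
      unfolding midpoint_def by (intro power_increasing) (auto simp: ceil_sqrt_le_iff power2_eq_square)
    moreover have "lg ?x \<le> 2 ^ ?m" "lg ?y \<le> 2 ^ ?m"
      using less_exp[of ?m] by linarith+
    ultimately have "T n \<le> (c + c') * n + (c + c') + 35 * (?x + ?y) + 150 * 2 ^ ?m + 60"
      unfolding T_def using square_le_two_pow[of ?m] by (simp add: algebra_simps)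
    also have "\<dots> \<le> (c + c' + 2000 * d + 3000) * n + (c + c' + 2000 * d + 3000)"
      using Q d[of n] by (simp add: algebra_simps)
    finally show ?case .
  qed
qed

lemma linear_time_constructible_counter_linear:
  assumes "counter_linear \<alpha>"
    and d: "\<And>n. \<alpha> n \<le> d * n + d"
  shows "linear_time_constructible \<alpha>"
proof -
  obtain p c where p: "computes_linear p c \<alpha>"
    using assms by (auto simp: counter_linear_def)
  \<comment> \<open>The input is moved to register 2 and the result from register 3, because
    registers 0 and 1 allow only some of the operations.\<close>
  let ?p = "move 0 2 ;; p 2 3 4 ;; move 3 1"
  have "wf_prog (p 2 3 4)"
    by (rule computes_linear_wf[OF p]) auto
  then have "\<exists>K. ok K ?p"
    unfolding wf_prog_def[symmetric] by (simp add: move_def)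
  moreover have "\<exists>t s. t \<le> (4 + c + 4 * d + 2) * n + (4 + c + 4 * d + 2) \<and>
      run ?p ((\<lambda>_. 0)(0 := n)) t s \<and> s 1 = \<alpha> n" for n
  proof -
    let ?s = "(\<lambda>_. 0)(0 := n) :: nat \<Rightarrow> nat" and ?s' = "(\<lambda>_. 0)(2 := n) :: nat \<Rightarrow> nat"
    have "runs (move 0 2) ?s (4 * n + 1) ?s'"
      using runs_move[of 0 2 ?s] by (rule runs_weaken) auto
    moreover have "runs (p 2 3 4) ?s' (c * n + c) (?s'(3 := \<alpha> n))"
      using computes_linear_runs[OF p, of 2 3 4 ?s'] by simp
    moreover have "runs (move 3 1) (?s'(3 := \<alpha> n)) (4 * \<alpha> n + 1) (?s'(1 := \<alpha> n))"
      using runs_move[of 3 1 "?s'(3 := \<alpha> n)"] by (rule runs_weaken) auto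
    ultimately have "runs ?p ?s (4 * n + 1 + (c * n + c + (4 * \<alpha> n + 1))) (?s'(1 := \<alpha> n))"
      by (intro runs_Seq)
    then obtain t where t: "t \<le> 4 * n + 1 + (c * n + c + (4 * \<alpha> n + 1))" "run ?p ?s t (?s'(1 := \<alpha> n))"
      unfolding runs_def by blast
    moreover have "4 * n + 1 + (c * n + c + (4 * \<alpha> n + 1)) \<le> (4 + c + 4 * d + 2) * n + (4 + c + 4 * d + 2)"
      using d[of n] by (simp add: algebra_simps)
    ultimately show ?thesis
      by (intro exI[of _ t] exI[of _ "?s'(1 := \<alpha> n)"]) auto
  qed
  ultimately show ?thesis
    by (rule linear_time_constructibleI)
qed

section \<open>Growth of the logarithm and its iterates\<close>

lemma mono_lg: "mono lg"
proof
  fix x y :: nat assume "x \<le> y"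
  also have "y \<le> 2 ^ lg y"
    using lg_le_iff[of "lg y" y] lg_ge_1 by simp
  finally show "lg x \<le> lg y"
    using lg_le_iff[of "lg y" x] lg_ge_1 by simp
qed

lemma le_two_pow_lg: "n \<le> 2 ^ lg n"
  using lg_le_iff[of "lg n" n] lg_ge_1 by simp

lemma lg_mult_le: "lg (x * y) \<le> lg x + lg y"
proof -
  have "x * y \<le> 2 ^ lg x * 2 ^ lg y"
    by (intro mult_le_mono le_two_pow_lg)
  then show ?thesis
    using lg_ge_1[of x] by (subst lg_le_iff) (auto simp: power_add)
qed

lemma lg_power_le: "lg (x ^ k) \<le> Suc k * lg x"
proof (induction k)
  case 0
  then show ?case using lg_ge_1[of x] by (simp add: lg_def)
next
  case (Suc k)
  then show ?case using lg_mult_le[of x "x ^ k"] by simp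
qed

lemma lg_const_mult_le: "lg (c * x) \<le> Suc (lg c) * lg x"
proof -
  have "lg c * 1 \<le> lg c * lg x"
    by (intro mult_le_mono lg_ge_1) auto
  with lg_mult_le[of c x] show ?thesis
    unfolding mult_Suc by linarith
qed

lemma mono_funpow_lg: "mono (lg ^^ m)"
  by (intro monoI funpow_mono mono_lg)

text \<open>One \<open>lg\<close> turns the exponent \<open>k\<close> into a constant factor; every
  further \<open>lg\<close> turns a constant factor \<open>c\<close> into at most
  \<open>Suc (lg c)\<close>.\<close>

lemma lg_iter_power_le: "\<exists>c. \<forall>n. (lg ^^ Suc m) (n ^ k) \<le> c * (lg ^^ Suc m) n"
proof (induction m)
  case 0
  show ?case
    by (rule exI[of _ "Suc k"]) (use lg_power_le[of _ k] in simp)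
next
  case (Suc m)
  then obtain c where c: "\<And>n. (lg ^^ Suc m) (n ^ k) \<le> c * (lg ^^ Suc m) n" by blast
  have "(lg ^^ Suc (Suc m)) (n ^ k) \<le> Suc (lg c) * (lg ^^ Suc (Suc m)) n" for n
  proof -
    have "lg ((lg ^^ Suc m) (n ^ k)) \<le> lg (c * (lg ^^ Suc m) n)"
      by (rule monoD[OF mono_lg c])
    also have "\<dots> \<le> Suc (lg c) * lg ((lg ^^ Suc m) n)"
      by (rule lg_const_mult_le)
    finally show ?thesis by simp
  qed
  then show ?case by blast
qed

lemma filterlim_lg: "filterlim lg at_top sequentially"
proof (subst filterlim_at_top, intro allI)
  fix Z :: nat
  have "Z \<le> lg n" if "n > 2 ^ Suc Z" for n
    using lg_le_iff[of "Suc Z" n] that by simp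
  then show "\<forall>\<^sub>F n in sequentially. Z \<le> lg n"
    using eventually_gt_at_top[of "2 ^ Suc Z"] by (rule eventually_mono[rotated])
qed

lemma filterlim_funpow_lg: "filterlim (lg ^^ m) at_top sequentially"
proof (induction m)
  case 0
  show ?case by (simp add: filterlim_ident id_def)
next
  case (Suc m)
  then show ?case using filterlim_compose[OF filterlim_lg Suc] by (simp add: o_def)
qed

text \<open>Substituting \<open>j\<close> for \<open>lg n\<close> reduces this to polynomial against
  exponential growth. The bound is proved with an extra factor 4 because \<open>n\<close> may be as
  small as just above \<open>2 ^ (lg n - 1)\<close>, so that \<open>n div 2\<close> is only known to
  reach \<open>2 ^ (lg n - 2)\<close>.\<close>

lemma eventually_poly_lg_le: "\<forall>\<^sub>F n in sequentially. (lg n + d) ^ k \<le> n div 2"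
proof -
  have "filterlim (\<lambda>j. (real d + real j) * ln 2) at_top sequentially"
    by (intro filterlim_at_top_mult_tendsto_pos[OF tendsto_const]
        filterlim_tendsto_add_at_top[OF tendsto_const] filterlim_real_sequentially) auto
  from filterlim_compose[OF tendsto_power_div_exp_0 this]
  have "(\<lambda>j. 2 ^ d / ln 2 ^ k * (((real d + real j) * ln 2) ^ k / exp ((real d + real j) * ln 2)))
      \<longlonglongrightarrow> 2 ^ d / ln 2 ^ k * 0"
    by (intro tendsto_mult_left)
  moreover have "2 ^ d / ln 2 ^ k * (((real d + real j) * ln 2) ^ k / exp ((real d + real j) * ln 2)) =
      (real j + real d) ^ k / 2 ^ j" for j
  proof -
    have "exp ((real d + real j) * ln 2) = 2 ^ d * 2 ^ j"
      using exp_of_nat_mult[of "d + j" "ln 2 :: real"] by (simp add: power_add)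
    then show ?thesis
      by (simp add: power_mult_distrib add.commute)
  qed
  ultimately have "(\<lambda>j. (real j + real d) ^ k / 2 ^ j) \<longlonglongrightarrow> 0"
    by simp
  then have "\<forall>\<^sub>F j in sequentially. (real j + real d) ^ k / 2 ^ j < 1 / 4"
    by (rule order_tendstoD) auto
  then have "\<forall>\<^sub>F j in sequentially. 4 * (j + d) ^ k \<le> 2 ^ j"
  proof eventually_elim
    case (elim j)
    then have "real (4 * (j + d) ^ k) \<le> real (2 ^ j)"
      by (simp add: field_simps)
    then show ?case by (simp only: of_nat_le_iff)
  qed
  then have "\<forall>\<^sub>F n in sequentially. 4 * (lg n + d) ^ k \<le> 2 ^ lg n"
    by (rule eventually_compose_filterlim[OF _ filterlim_lg])
  then show ?thesis
    using eventually_ge_at_top[of 3]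
  proof eventually_elim
    case (elim n)
    have "\<not> lg n \<le> 1"
      using elim lg_le_iff[of 1 n] by simp
    then obtain i where i: "lg n = Suc (Suc i)"
      by (cases "lg n"; cases "lg n - 1") auto
    have "\<not> n \<le> 2 ^ Suc i"
      using i lg_le_iff[of "Suc i" n] by simp
    then have "2 ^ i \<le> n div 2"
      by simp
    then show ?case
      using elim i by simp
  qed
qed

section \<open>Properties of the iterated logarithm\<close>

lemma lstar_le_Suc: "lstar n \<le> Suc (lstar (lg n))"
  by (subst lstar.simps) simp

lemma lstar_le_iter: "lstar n \<le> m + lstar ((lg ^^ m) n)"
proof (induction m)
  case (Suc m)
  then show ?case using lstar_le_Suc[of "(lg ^^ m) n"] by simp
qed simp

lemma lstar_le: "lstar n \<le> n"
proof (induction n rule: lstar.induct)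
  case (1 n)
  show ?case
  proof (cases "n \<le> 1")
    case False
    then have "Suc ((n - 1) div 2) < n \<or> n = 2" by presburger
    moreover have "lg 2 = 1" by (simp add: lg_def)
    ultimately have "lg n < n" using lg_le_half[of n] by auto
    then show ?thesis using 1 False by (subst lstar.simps) auto
  qed (simp add: lstar.simps)
qed

lemma mono_lstar: "mono lstar"
proof
  fix x y :: nat assume "x \<le> y"
  then show "lstar x \<le> lstar y"
  proof (induction y arbitrary: x rule: lstar.induct)
    case (1 y)
    show ?case
    proof (cases "x \<le> 1")
      case False
      then show ?thesis
        using 1 monoD[OF mono_lg, of x y] lstar.simps[of x] lstar.simps[of y] by auto
    qed (simp add: lstar.simps)
  qed
qed

lemma lgstar_eq_lstar:
  assumes "n \<ge> 1"
  shows "lgstar n = lstar n"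
proof -
  have "(lg ^^ lstar n) n = 1 \<and> (LEAST m. (lg ^^ m) n = 1) = lstar n"
    using assms
  proof (induction n rule: lstar.induct)
    case (1 n)
    show ?case
    proof (cases "n = 1")
      case True
      then show ?thesis by (simp add: lstar.simps)
    next
      case False
      with 1 have n: "\<not> n \<le> 1" by simp
      have IH: "(lg ^^ lstar (lg n)) (lg n) = 1" "(LEAST m. (lg ^^ m) (lg n) = 1) = lstar (lg n)"
        using 1(1)[OF n lg_ge_1] by auto
      have *: "lstar n = Suc (lstar (lg n))"
        using n by (subst lstar.simps) simp
      have "(LEAST m. (lg ^^ m) n = 1) = Suc (LEAST m. (lg ^^ Suc m) n = 1)"
        by (rule Least_Suc[where n = "Suc (lstar (lg n))"]) (use IH n in \<open>auto simp: funpow_swap1\<close>)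
      then show ?thesis
        using IH * by (simp add: funpow_swap1)
    qed
  qed
  then show ?thesis by (simp add: lgstar_def)
qed

lemma filterlim_lstar: "filterlim lstar at_top sequentially"
proof (subst filterlim_at_top, intro allI)
  fix Z :: nat
  show "\<forall>\<^sub>F n in sequentially. Z \<le> lstar n"
  proof (induction Z)
    case (Suc Z)
    have "\<forall>\<^sub>F n in sequentially. Z \<le> lstar (lg n)"
      by (rule eventually_compose_filterlim[OF Suc filterlim_lg])
    then show ?case
      using eventually_ge_at_top[of 2]
      by eventually_elim (subst lstar.simps, simp)
  qed simp
qed

section \<open>The iteration order on factors\<close>

text \<open>The bound \<open>2 \<le> \<alpha> n\<close> is demanded for every \<open>n\<close>, so that \<open>lg (\<alpha> n)\<close> controls \<open>\<alpha> n\<close>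
  everywhere; changing finitely many values does not matter for the iteration order.\<close>

definition admissible :: "(nat \<Rightarrow> nat) \<Rightarrow> bool" where
  "admissible \<alpha> \<longleftrightarrow> mono \<alpha> \<and> (\<forall>n. 2 \<le> \<alpha> n) \<and> \<alpha> \<le>\<^sub>a (\<lambda>n. n) \<and> f_consistent \<alpha> \<and> counter_linear \<alpha>"

lemma admissibleD:
  assumes "admissible \<alpha>"
  shows "mono \<alpha>" "\<And>n. 2 \<le> \<alpha> n" "\<forall>\<^sub>F n in sequentially. \<alpha> n \<le> n" "f_consistent \<alpha>" "counter_linear \<alpha>"
  using assms by (auto simp: admissible_def le_ae_def)

lemma admissible_linear_bound:
  assumes "admissible \<alpha>"
  shows "\<exists>d. \<forall>n. \<alpha> n \<le> d * n + d"
proof -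
  obtain N where N: "\<And>n. n \<ge> N \<Longrightarrow> \<alpha> n \<le> n"
    using admissibleD(3)[OF assms] by (auto simp: eventually_sequentially)
  have "\<alpha> n \<le> Suc (\<alpha> N) * n + Suc (\<alpha> N)" for n
  proof (cases "n \<ge> N")
    case True
    then show ?thesis using N[of n] by simp
  next
    case False
    then show ?thesis using monoD[OF admissibleD(1)[OF assms], of n N] by simp
  qed
  then show ?thesis by blast
qed

lemma admissible_type1_factor:
  assumes "admissible \<alpha>"
  shows "type1_factor \<alpha> (\<lambda>n. n * \<alpha> n)"
proof -
  obtain d where "\<And>n. \<alpha> n \<le> d * n + d"
    using admissible_linear_bound[OF assms] by blast
  then have "linear_time_constructible \<alpha>"
    using linear_time_constructible_counter_linear admissibleD(5)[OF assms] by blast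
  moreover have "n * \<alpha> n \<le> (n + 1) * \<alpha> (n + 1)" for n
    by (intro mult_le_mono monoD[OF admissibleD(1)[OF assms]]) auto
  moreover have "n \<le> n * \<alpha> n" for n
    using admissibleD(2)[OF assms, of n] by (cases "\<alpha> n") auto
  ultimately show ?thesis
    using assms by (auto simp: type1_factor_def is_bound_def admissible_def le_ae_def)
qed

text \<open>The iterates never fall below \<open>n\<close>, so by monotonicity every application
  multiplies by at least \<open>\<alpha> n\<close>.\<close>

lemma iterate_lower_bound:
  fixes \<alpha> :: "nat \<Rightarrow> nat"
  assumes "mono \<alpha>" "1 \<le> \<alpha> n"
  shows "n * \<alpha> n ^ j \<le> ((\<lambda>n. n * \<alpha> n) ^^ j) n"
proof (induction j)
  case (Suc j)
  have "n * 1 \<le> n * \<alpha> n ^ j"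
    using assms by (intro mult_le_mono) auto
  with Suc have "n \<le> ((\<lambda>n. n * \<alpha> n) ^^ j) n" by linarith
  then have "(n * \<alpha> n ^ j) * \<alpha> n \<le> ((\<lambda>n. n * \<alpha> n) ^^ j) n * \<alpha> (((\<lambda>n. n * \<alpha> n) ^^ j) n)"
    by (intro mult_le_mono Suc monoD[OF assms(1)])
  then show ?case by (simp add: mult_ac)
qed simp

text \<open>One application of the left bound is dominated by \<open>Suc k\<close> applications of
  the right one, which supply the factor \<open>\<alpha>' n ^ Suc k\<close>. Using
  \<open>Suc k\<close> keeps the number of iterations positive when \<open>k = 0\<close>.\<close>

lemma le_it_if_power_bound:
  fixes \<alpha> \<alpha>' :: "nat \<Rightarrow> nat"
  assumes "mono \<alpha>'" and "\<forall>\<^sub>F n in sequentially. 1 \<le> \<alpha> n" and "\<forall>\<^sub>F n in sequentially. 1 \<le> \<alpha>' n"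
    and "\<forall>\<^sub>F n in sequentially. \<alpha> n \<le> \<alpha>' n ^ k"
  shows "(\<lambda>n. n * \<alpha> n) \<le>\<^sub>i\<^sub>t (\<lambda>n. n * \<alpha>' n)"
proof -
  let ?b = "\<lambda>n. n * \<alpha> n" and ?b' = "\<lambda>n. n * \<alpha>' n"
  have "\<forall>\<^sub>F n in sequentially. 1 \<le> \<alpha> n \<and> 1 \<le> \<alpha>' n \<and> \<alpha> n \<le> \<alpha>' n ^ k"
    using assms(2-4) by eventually_elim auto
  then obtain N where N: "\<And>n. n \<ge> N \<Longrightarrow> 1 \<le> \<alpha> n \<and> 1 \<le> \<alpha>' n \<and> \<alpha> n \<le> \<alpha>' n ^ k"
    by (auto simp: eventually_sequentially)
  have b': "mono ?b'"
    by (intro monoI mult_le_mono monoD[OF assms(1)])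
  have le: "?b n \<le> (?b' ^^ Suc k) n" if "n \<ge> N" for n
  proof -
    have "\<alpha>' n ^ k \<le> \<alpha>' n ^ Suc k"
      using N[OF that] by (intro power_increasing) auto
    then have "\<alpha> n \<le> \<alpha>' n ^ Suc k"
      using N[OF that] by linarith
    then have "?b n \<le> n * \<alpha>' n ^ Suc k"
      by (intro mult_le_mono) auto
    also have "\<dots> \<le> (?b' ^^ Suc k) n"
      using N[OF that] by (intro iterate_lower_bound[OF assms(1)]) auto
    finally show ?thesis .
  qed
  \<comment> \<open>The first conjunct keeps every iterate above the threshold \<open>N\<close>, so
    that \<open>le\<close> applies to it.\<close>
  have iter: "n \<le> (?b ^^ m) n \<and> (?b ^^ m) n \<le> (?b' ^^ (m * Suc k)) n" if "n \<ge> N" for n m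
  proof (induction m)
    case (Suc m)
    let ?x = "(?b ^^ m) n"
    have x: "n \<le> ?x" "?x \<ge> N" using Suc that by auto
    have "?x * 1 \<le> ?b ?x" using N[OF x(2)] by (intro mult_le_mono) auto
    with x(1) have "n \<le> (?b ^^ Suc m) n"
      unfolding funpow.simps(2) o_apply by linarith
    moreover have "?b ?x \<le> (?b' ^^ Suc k) ((?b' ^^ (m * Suc k)) n)"
      using le[OF x(2)] funpow_mono[OF b', of ?x "(?b' ^^ (m * Suc k)) n" "Suc k"] Suc
      by (meson le_trans)
    moreover have "(?b' ^^ Suc k) ((?b' ^^ (m * Suc k)) n) = (?b' ^^ (Suc m * Suc k)) n"
      by (simp only: mult_Suc funpow_add o_apply)
    ultimately show ?case by simp
  qed simp
  show ?thesis
    unfolding le_it_def set_le_ae_def It_def le_ae_def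
  proof safe
    fix m :: nat assume "m \<ge> 1"
    have "\<forall>\<^sub>F n in sequentially. (?b ^^ m) n \<le> (?b' ^^ (m * Suc k)) n"
      using eventually_ge_at_top[of N] by eventually_elim (use iter in blast)
    moreover have "m * Suc k \<ge> 1" using \<open>m \<ge> 1\<close> by simp
    ultimately show "\<exists>\<beta>2\<in>{?b' ^^ m |m. 1 \<le> m}. \<forall>\<^sub>F n in sequentially. (?b ^^ m) n \<le> \<beta>2 n"
      by blast
  qed
qed

text \<open>Here f-consistency enters: an iterate of size at most \<open>n * \<alpha> n ^ l\<close>
  is at most \<open>n ^ Suc l\<close>, so one more application contributes only another power of
  \<open>\<alpha> n\<close>.\<close>

lemma iterate_upper_bound:
  assumes "mono \<alpha>" "f_consistent \<alpha>" "\<forall>\<^sub>F n in sequentially. \<alpha> n \<le> n"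
  shows "\<exists>l. \<forall>\<^sub>F n in sequentially. ((\<lambda>n. n * \<alpha> n) ^^ j) n \<le> n * \<alpha> n ^ l"
proof (induction j)
  case 0
  show ?case by (intro exI[of _ 0]) simp
next
  case (Suc j)
  then obtain l where l: "\<forall>\<^sub>F n in sequentially. ((\<lambda>n. n * \<alpha> n) ^^ j) n \<le> n * \<alpha> n ^ l" by blast
  obtain l' where l': "\<forall>\<^sub>F n in sequentially. \<alpha> (n ^ Suc l) \<le> \<alpha> n ^ l'"
    using assms(2) unfolding f_consistent_def le_ae_def by blast
  have "\<forall>\<^sub>F n in sequentially. ((\<lambda>n. n * \<alpha> n) ^^ Suc j) n \<le> n * \<alpha> n ^ (l + l')"
    using l l' assms(3)
  proof eventually_elim
    case (elim n)
    let ?x = "((\<lambda>n. n * \<alpha> n) ^^ j) n"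
    have "n * \<alpha> n ^ l \<le> n * n ^ l"
      using elim by (intro mult_le_mono power_mono) auto
    with elim(1) have "?x \<le> n ^ Suc l"
      unfolding power_Suc by (rule le_trans)
    then have "\<alpha> ?x \<le> \<alpha> n ^ l'"
      using elim(2) monoD[OF assms(1)] le_trans by blast
    then have "?x * \<alpha> ?x \<le> (n * \<alpha> n ^ l) * \<alpha> n ^ l'"
      using elim(1) by (intro mult_le_mono)
    then show ?case by (simp add: power_add mult_ac)
  qed
  then show ?case by blast
qed

lemma power_bound_if_le_it:
  assumes "(\<lambda>n. n * \<alpha> n) \<le>\<^sub>i\<^sub>t (\<lambda>n. n * \<alpha>' n)"
    and "mono \<alpha>'" "f_consistent \<alpha>'" "\<forall>\<^sub>F n in sequentially. \<alpha>' n \<le> n"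
  shows "\<exists>k. \<forall>\<^sub>F n in sequentially. \<alpha> n \<le> \<alpha>' n ^ k"
proof -
  have "(\<lambda>n. n * \<alpha> n) ^^ 1 \<in> It (\<lambda>n. n * \<alpha> n)"
    unfolding It_def by blast
  then obtain j where j: "\<forall>\<^sub>F n in sequentially. n * \<alpha> n \<le> ((\<lambda>n. n * \<alpha>' n) ^^ j) n"
    using assms(1) unfolding le_it_def set_le_ae_def le_ae_def by (auto simp: It_def)
  obtain k where k: "\<forall>\<^sub>F n in sequentially. ((\<lambda>n. n * \<alpha>' n) ^^ j) n \<le> n * \<alpha>' n ^ k"
    using iterate_upper_bound[OF assms(2-4)] by blast
  have "\<forall>\<^sub>F n in sequentially. \<alpha> n \<le> \<alpha>' n ^ k"
    using j k eventually_gt_at_top[of 0]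
  proof eventually_elim
    case (elim n)
    then have "n * \<alpha> n \<le> n * \<alpha>' n ^ k" by linarith
    then show ?case using elim(3) by simp
  qed
  then show ?thesis by blast
qed

lemma ll_powD: "\<alpha> \<lless>\<^sub>p\<^sub>o\<^sub>w \<alpha>' \<Longrightarrow> \<forall>\<^sub>F n in sequentially. \<alpha> n ^ k \<le> \<alpha>' n"
  by (auto simp: ll_pow_def le_ae_def)

lemma ll_pow_trans:
  assumes "\<alpha>1 \<lless>\<^sub>p\<^sub>o\<^sub>w \<alpha>2" "\<alpha>2 \<lless>\<^sub>p\<^sub>o\<^sub>w \<alpha>3"
  shows "\<alpha>1 \<lless>\<^sub>p\<^sub>o\<^sub>w \<alpha>3"
  unfolding ll_pow_def le_ae_def
proof
  fix k
  show "\<forall>\<^sub>F n in sequentially. \<alpha>1 n ^ k \<le> \<alpha>3 n"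
    using ll_powD[OF assms(1), of k] ll_powD[OF assms(2), of 1]
    by eventually_elim simp
qed

lemma ll_pow_not_power_bound:
  assumes "\<alpha> \<lless>\<^sub>p\<^sub>o\<^sub>w \<alpha>'" "\<And>n. 2 \<le> \<alpha> n"
  shows "\<not> (\<forall>\<^sub>F n in sequentially. \<alpha>' n \<le> \<alpha> n ^ k)"
proof
  assume "\<forall>\<^sub>F n in sequentially. \<alpha>' n \<le> \<alpha> n ^ k"
  then have "\<forall>\<^sub>F n in sequentially. False"
    using ll_powD[OF assms(1), of "Suc k"]
  proof eventually_elim
    case (elim n)
    have "\<alpha> n ^ k < \<alpha> n ^ Suc k"
      using assms(2)[of n] by (intro power_strict_increasing) auto
    with elim show ?case by simp
  qed
  then show False by simp
qed

lemma ll_pow_less_it: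
  assumes "admissible \<alpha>" "admissible \<alpha>'" "\<alpha> \<lless>\<^sub>p\<^sub>o\<^sub>w \<alpha>'"
  shows "(\<lambda>n. n * \<alpha> n) \<prec>\<^sub>i\<^sub>t (\<lambda>n. n * \<alpha>' n)"
proof -
  have ge: "\<forall>\<^sub>F n in sequentially. 1 \<le> \<alpha> n" if "admissible \<alpha>" for \<alpha>
    using admissibleD(2)[OF that] by (intro always_eventually allI) (meson le_trans one_le_numeral)
  have "(\<lambda>n. n * \<alpha> n) \<le>\<^sub>i\<^sub>t (\<lambda>n. n * \<alpha>' n)"
    using ll_powD[OF assms(3), of 1] assms
    by (intro le_it_if_power_bound[where k = 1] admissibleD ge) auto
  moreover have "\<not> (\<lambda>n. n * \<alpha>' n) \<le>\<^sub>i\<^sub>t (\<lambda>n. n * \<alpha> n)"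
    using power_bound_if_le_it admissibleD[OF assms(1)] ll_pow_not_power_bound[OF assms(3)] by blast
  ultimately show ?thesis
    by (simp add: less_it_def equiv_it_def)
qed

section \<open>Midpoints\<close>

lemma mono_ceil_sqrt: "mono ceil_sqrt"
  by (intro monoI) (meson ceil_sqrt_le_iff le_refl le_trans)

lemma le_ceil_sqrt_square: "p \<le> ceil_sqrt p ^ 2"
  using ceil_sqrt_le_iff by blast

lemma ceil_sqrt_geI: "s ^ 2 \<le> p \<Longrightarrow> s \<le> ceil_sqrt p"
  using le_ceil_sqrt_square[of p] power2_nat_le_eq_le le_trans by blast

lemma ceil_sqrt_mult_square_le: "ceil_sqrt (c ^ 2 * p) \<le> c * ceil_sqrt p"
  using le_ceil_sqrt_square[of p] by (simp add: ceil_sqrt_le_iff power_mult_distrib)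

lemma midpoint_mono:
  assumes "x \<le> x'" "y \<le> y'"
  shows "midpoint x y \<le> midpoint x' y'"
  unfolding midpoint_def
  by (intro power_increasing monoD[OF mono_ceil_sqrt] mult_le_mono monoD[OF mono_lg] assms) auto

lemma midpoint_ge_2: "2 \<le> midpoint x y"
proof -
  have "1 * 1 \<le> lg x * lg y"
    by (intro mult_le_mono lg_ge_1)
  then have "1 \<le> ceil_sqrt (lg x * lg y)"
    by (intro ceil_sqrt_geI) simp
  then have "(2::nat) ^ 1 \<le> 2 ^ ceil_sqrt (lg x * lg y)"
    by (intro power_increasing) auto
  then show ?thesis by (simp add: midpoint_def)
qed

text \<open>Both logarithms grow by at most the factor \<open>Suc k\<close>, and the root of its
  square is \<open>Suc k\<close> again. This gives f-consistency of midpoints.\<close>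

lemma midpoint_power_le: "midpoint (x ^ k) (y ^ k) \<le> midpoint x y ^ Suc k"
proof -
  have "lg (x ^ k) * lg (y ^ k) \<le> (Suc k * lg x) * (Suc k * lg y)"
    by (intro mult_le_mono lg_power_le)
  also have "\<dots> = Suc k ^ 2 * (lg x * lg y)"
    by (simp only: power2_eq_square mult_ac)
  finally have "ceil_sqrt (lg (x ^ k) * lg (y ^ k)) \<le> Suc k * ceil_sqrt (lg x * lg y)"
    using ceil_sqrt_mult_square_le monoD[OF mono_ceil_sqrt] le_trans by blast
  then have "(2::nat) ^ ceil_sqrt (lg (x ^ k) * lg (y ^ k)) \<le> 2 ^ (ceil_sqrt (lg x * lg y) * Suc k)"
    by (intro power_increasing) (auto simp: mult_ac)
  then show ?thesis by (simp only: midpoint_def power_mult)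
qed

lemma two_pow_lg_le_square:
  assumes "x \<ge> 2"
  shows "2 ^ lg x \<le> x ^ 2"
proof (cases "x = 2")
  case True
  then show ?thesis by (simp add: lg_def)
next
  case False
  then have "2 * x + 2 \<le> x * x"
    using assms mult_le_mono1[of 3 x x] by linarith
  then show ?thesis
    using two_pow_lg_le[of x] by (simp add: power2_eq_square)
qed

text \<open>The 2 in the exponent pays for rounding in \<open>lg x\<close>: only
  \<open>2 ^ lg x \<le> x ^ 2\<close> is available.\<close>

lemma lg_mult_le_lg:
  assumes "x \<ge> 2" "x ^ (2 * c) \<le> y"
  shows "c * lg x \<le> lg y"
proof -
  have "(2::nat) ^ (c * lg x) = (2 ^ lg x) ^ c"
    by (metis mult.commute power_mult)
  also have "\<dots> \<le> (x ^ 2) ^ c"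
    by (intro power_mono two_pow_lg_le_square assms) auto
  also have "\<dots> \<le> y"
    using assms by (simp add: power_mult)
  also have "\<dots> \<le> 2 ^ lg y"
    by (rule le_two_pow_lg)
  finally show ?thesis by (simp add: power_le_imp_le_exp)
qed

text \<open>The hypothesis gives \<open>k ^ 2 * lg x \<le> lg y\<close>, so the product under the
  root is at least the square of \<open>k * lg x\<close>.\<close>

lemma power_le_midpoint:
  assumes "x \<ge> 2" "x ^ (2 * k ^ 2) \<le> y"
  shows "x ^ k \<le> midpoint x y"
proof -
  have "(k * lg x) ^ 2 = lg x * (k ^ 2 * lg x)"
    by (simp add: power2_eq_square)
  also have "\<dots> \<le> lg x * lg y"
    by (intro mult_le_mono lg_mult_le_lg assms) auto
  finally have "k * lg x \<le> ceil_sqrt (lg x * lg y)"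
    by (rule ceil_sqrt_geI)
  then have "(2::nat) ^ (lg x * k) \<le> midpoint x y"
    unfolding midpoint_def by (intro power_increasing) (auto simp: mult.commute)
  moreover have "x ^ k \<le> 2 ^ (lg x * k)"
    unfolding power_mult by (intro power_mono le_two_pow_lg) auto
  ultimately show ?thesis by simp
qed

text \<open>Of the factor 4, one 2 absorbs rounding up the square root and the other the passage
  from \<open>2 ^ lg y\<close> to \<open>y ^ 2\<close>.\<close>

lemma midpoint_power_le_right:
  assumes "x \<ge> 2" "x ^ (2 * (4 * k) ^ 2) \<le> y" "y \<ge> 2"
  shows "midpoint x y ^ k \<le> y"
proof (cases "k = 0")
  case False
  let ?s = "ceil_sqrt (lg x * lg y)" and ?K = "4 * k"
  have K: "?K ^ 2 * lg x \<le> lg y"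
    by (intro lg_mult_le_lg assms)
  have "?K * 1 \<le> ?K ^ 2 * lg x"
    using lg_ge_1[of x] False unfolding power2_eq_square mult.assoc by (intro mult_le_mono) auto
  with K have "?K \<le> lg y" by linarith
  \<comment> \<open>The predecessor \<open>t\<close> of \<open>?s\<close> lies below the true root,
    so \<open>?K * t \<le> lg y\<close>; the remaining \<open>?K\<close> is itself at most
    \<open>lg y\<close>.\<close>
  have "?K * ?s \<le> 2 * lg y"
  proof (cases ?s)
    case (Suc t)
    have "\<not> ?s \<le> t" using Suc by simp
    then have "t ^ 2 < lg x * lg y"
      by (simp add: ceil_sqrt_le_iff)
    then have "(?K * t) ^ 2 \<le> (?K ^ 2 * lg x) * lg y"
      by (simp add: power_mult_distrib)
    also have "\<dots> \<le> lg y * lg y"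
      by (intro mult_le_mono K) auto
    finally have "?K * t \<le> lg y"
      by (simp only: power2_nat_le_eq_le flip: power2_eq_square)
    then show ?thesis
      using Suc \<open>?K \<le> lg y\<close> by simp
  qed simp
  then have "?s * k * 2 \<le> lg y" by (simp add: mult_ac)
  then have "(2::nat) ^ (?s * k * 2) \<le> 2 ^ lg y"
    by (intro power_increasing) auto
  also have "\<dots> \<le> y ^ 2"
    by (intro two_pow_lg_le_square assms)
  finally have "(midpoint x y ^ k) ^ 2 \<le> y ^ 2"
    by (simp only: midpoint_def power_mult)
  then show ?thesis by (simp only: power2_nat_le_eq_le)
qed (use assms in simp)

lemma ll_pow_midpoint_left:
  assumes "admissible \<alpha>" "\<alpha> \<lless>\<^sub>p\<^sub>o\<^sub>w \<alpha>'"
  shows "\<alpha> \<lless>\<^sub>p\<^sub>o\<^sub>w (\<lambda>n. midpoint (\<alpha> n) (\<alpha>' n))"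
  unfolding ll_pow_def le_ae_def
proof
  fix k
  show "\<forall>\<^sub>F n in sequentially. \<alpha> n ^ k \<le> midpoint (\<alpha> n) (\<alpha>' n)"
    using ll_powD[OF assms(2), of "2 * k ^ 2"]
    by eventually_elim (intro power_le_midpoint admissibleD(2)[OF assms(1)])
qed

lemma ll_pow_midpoint_right:
  assumes "admissible \<alpha>" "admissible \<alpha>'" "\<alpha> \<lless>\<^sub>p\<^sub>o\<^sub>w \<alpha>'"
  shows "(\<lambda>n. midpoint (\<alpha> n) (\<alpha>' n)) \<lless>\<^sub>p\<^sub>o\<^sub>w \<alpha>'"
  unfolding ll_pow_def le_ae_def
proof
  fix k
  show "\<forall>\<^sub>F n in sequentially. midpoint (\<alpha> n) (\<alpha>' n) ^ k \<le> \<alpha>' n"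
    using ll_powD[OF assms(3), of "2 * (4 * k) ^ 2"]
    by eventually_elim (intro midpoint_power_le_right admissibleD(2)[OF assms(1)] admissibleD(2)[OF assms(2)])
qed

lemma admissible_midpoint:
  assumes "admissible \<alpha>" "admissible \<alpha>'" "\<alpha> \<lless>\<^sub>p\<^sub>o\<^sub>w \<alpha>'"
  shows "admissible (\<lambda>n. midpoint (\<alpha> n) (\<alpha>' n))"
  unfolding admissible_def
proof (intro conjI)
  show "mono (\<lambda>n. midpoint (\<alpha> n) (\<alpha>' n))"
    by (intro monoI midpoint_mono admissibleD(1)[OF assms(1), THEN monoD] admissibleD(1)[OF assms(2), THEN monoD])
  show "\<forall>n. 2 \<le> midpoint (\<alpha> n) (\<alpha>' n)"
    by (simp add: midpoint_ge_2)
  show "(\<lambda>n. midpoint (\<alpha> n) (\<alpha>' n)) \<le>\<^sub>a (\<lambda>n. n)"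
    unfolding le_ae_def
    using ll_powD[OF ll_pow_midpoint_right[OF assms], of 1] admissibleD(3)[OF assms(2)]
    by eventually_elim simp
  show "f_consistent (\<lambda>n. midpoint (\<alpha> n) (\<alpha>' n))"
    unfolding f_consistent_def
  proof
    fix k
    obtain l where l: "\<forall>\<^sub>F n in sequentially. \<alpha> (n ^ k) \<le> \<alpha> n ^ l"
      using admissibleD(4)[OF assms(1)] unfolding f_consistent_def le_ae_def by blast
    obtain l' where l': "\<forall>\<^sub>F n in sequentially. \<alpha>' (n ^ k) \<le> \<alpha>' n ^ l'"
      using admissibleD(4)[OF assms(2)] unfolding f_consistent_def le_ae_def by blast
    have "\<forall>\<^sub>F n in sequentially. midpoint (\<alpha> (n ^ k)) (\<alpha>' (n ^ k)) \<le> midpoint (\<alpha> n) (\<alpha>' n) ^ Suc (l + l')"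
      using l l'
    proof eventually_elim
      case (elim n)
      have "\<alpha> n ^ l \<le> \<alpha> n ^ (l + l')" "\<alpha>' n ^ l' \<le> \<alpha>' n ^ (l + l')"
        using admissibleD(2)[OF assms(1), of n] admissibleD(2)[OF assms(2), of n]
        by (auto intro!: power_increasing)
      with elim have "midpoint (\<alpha> (n ^ k)) (\<alpha>' (n ^ k)) \<le> midpoint (\<alpha> n ^ (l + l')) (\<alpha>' n ^ (l + l'))"
        by (intro midpoint_mono) auto
      also have "\<dots> \<le> midpoint (\<alpha> n) (\<alpha>' n) ^ Suc (l + l')"
        by (rule midpoint_power_le)
      finally show ?case .
    qed
    then show "\<exists>l. (\<lambda>n. midpoint (\<alpha> (n ^ k)) (\<alpha>' (n ^ k))) \<le>\<^sub>a (\<lambda>n. midpoint (\<alpha> n) (\<alpha>' n) ^ l)"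
      unfolding le_ae_def by blast
  qed
  obtain d where d: "\<And>n. \<alpha> n \<le> d * n + d"
    using admissible_linear_bound[OF assms(1)] by blast
  obtain d' where d': "\<And>n. \<alpha>' n \<le> d' * n + d'"
    using admissible_linear_bound[OF assms(2)] by blast
  have "\<alpha> n \<le> (d + d') * n + (d + d')" "\<alpha>' n \<le> (d + d') * n + (d + d')" for n
    using d[of n] d'[of n] by (simp_all add: algebra_simps)
  then show "counter_linear (\<lambda>n. midpoint (\<alpha> n) (\<alpha>' n))"
    by (intro counter_linear_midpoint[of _ _ "d + d'"] admissibleD(5)[OF assms(1)] admissibleD(5)[OF assms(2)])
qed

section \<open>Maximal chains\<close>

text \<open>Unions of nonempty chains of such sets are again such sets, so a maximal one exists. A
  point of \<open>A\<close> in a gap of it would be comparable with all its elements and could be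
  inserted.\<close>

lemma dense_maximal_chain:
  fixes R :: "'a \<Rightarrow> 'a \<Rightarrow> bool"
  assumes "transp R"
    and dense: "\<forall>x\<in>A. \<forall>y\<in>A. R x y \<longrightarrow> (\<exists>z\<in>A. R x z \<and> R z y)"
    and C0: "C0 \<subseteq> A" "\<forall>x\<in>C0. \<forall>y\<in>C0. x \<noteq> y \<longrightarrow> R x y \<or> R y x"
  shows "\<exists>C. C0 \<subseteq> C \<and> C \<subseteq> A \<and> (\<forall>x\<in>C. \<forall>y\<in>C. x \<noteq> y \<longrightarrow> R x y \<or> R y x) \<and>
    (\<forall>x\<in>C. \<forall>y\<in>C. R x y \<longrightarrow> (\<exists>z\<in>C. R x z \<and> R z y))"
proof -
  have trans: "R x y \<Longrightarrow> R y z \<Longrightarrow> R x z" for x y z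
    using \<open>transp R\<close> by (rule transpD)
  define \<C> where "\<C> = {C. C0 \<subseteq> C \<and> C \<subseteq> A \<and> (\<forall>x\<in>C. \<forall>y\<in>C. x \<noteq> y \<longrightarrow> R x y \<or> R y x)}"
  have "\<exists>M\<in>\<C>. \<forall>X\<in>\<C>. M \<subseteq> X \<longrightarrow> X = M"
  proof (rule subset_Zorn_nonempty)
    show "\<C> \<noteq> {}"
      using C0 unfolding \<C>_def by blast
    fix K assume K: "K \<noteq> {}" "subset.chain \<C> K"
    have "R x y \<or> R y x" if xy: "x \<in> \<Union>K" "y \<in> \<Union>K" "x \<noteq> y" for x y
    proof -
      obtain X Y where XY: "x \<in> X" "y \<in> Y" "X \<in> K" "Y \<in> K" using xy by blast
      then have "X \<subseteq> Y \<or> Y \<subseteq> X"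
        using K(2) unfolding subset_chain_def by blast
      then obtain Z where "x \<in> Z" "y \<in> Z" "Z \<in> K" using XY by blast
      moreover have "Z \<in> \<C>" using \<open>Z \<in> K\<close> K(2) unfolding subset_chain_def by blast
      ultimately show ?thesis using xy(3) unfolding \<C>_def by blast
    qed
    moreover have KC: "C0 \<subseteq> X \<and> X \<subseteq> A" if "X \<in> K" for X
      using K(2) that unfolding subset_chain_def \<C>_def by blast
    have "C0 \<subseteq> \<Union>K"
      using K(1) KC by blast
    moreover have "\<Union>K \<subseteq> A"
      using KC by blast
    ultimately show "\<Union>K \<in> \<C>"
      unfolding \<C>_def by blast
  qed
  then obtain C where C: "C \<in> \<C>" and max: "\<And>X. X \<in> \<C> \<Longrightarrow> C \<subseteq> X \<Longrightarrow> X = C"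
    by blast
  have chain: "R x y \<or> R y x" if "x \<in> C" "y \<in> C" "x \<noteq> y" for x y
    using C that unfolding \<C>_def by blast
  have "\<exists>z\<in>C. R x z \<and> R z y" if xy: "x \<in> C" "y \<in> C" "R x y" for x y
  proof (rule ccontr)
    assume no: "\<not> (\<exists>z\<in>C. R x z \<and> R z y)"
    have "x \<in> A" "y \<in> A"
      using xy C unfolding \<C>_def by blast+
    then obtain z where z: "z \<in> A" "R x z" "R z y"
      using dense xy by blast
    \<comment> \<open>With nothing between \<open>x\<close> and \<open>y\<close>, each
      \<open>u\<close> is \<open>x\<close> or below it, or is \<open>y\<close> or above it;
      transitivity through \<open>x\<close> or \<open>y\<close> compares it with
      \<open>z\<close>.\<close>
    have "R u z \<or> R z u" if "u \<in> C" for u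
      using no that chain[OF that xy(1)] chain[OF that xy(2)] trans z by blast
    then have "insert z C \<in> \<C>"
      using C z(1) unfolding \<C>_def by auto
    then have "z \<in> C"
      using max[of "insert z C"] by blast
    then show False
      using no z by blast
  qed
  then show ?thesis
    using C unfolding \<C>_def by blast
qed

section \<open>The factors of the initial chain and their order\<close>

lemma admissible_two: "admissible (\<lambda>n. 2)"
  unfolding admissible_def le_ae_def f_consistent_def
  by (auto simp: counter_linear_two mono_def eventually_ge_at_top intro!: exI[of _ 1])

lemma le_half_square: "n \<le> ((n + 1) div 2 + 2) ^ 2" for n :: nat
proof -
  have "n \<le> 2 * ((n + 1) div 2 + 2)"
    by presburger
  also have "\<dots> \<le> ((n + 1) div 2 + 2) * ((n + 1) div 2 + 2)"
    by (intro mult_le_mono) auto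
  finally show ?thesis
    by (simp only: power2_eq_square)
qed

text \<open>Halving leaves room for the summand 2 below \<open>n\<close>, and the square of the
  factor still dominates \<open>n\<close>, so its class modulo powers is that of
  \<open>n\<close>.\<close>

lemma admissible_half: "admissible (\<lambda>n. (n + 1) div 2 + 2)"
  unfolding admissible_def
proof (intro conjI)
  show "mono (\<lambda>n. (n + 1) div 2 + 2 :: nat)"
    by (intro monoI add_mono div_le_mono) auto
  show "(\<lambda>n. (n + 1) div 2 + 2) \<le>\<^sub>a (\<lambda>n. n)"
    unfolding le_ae_def using eventually_ge_at_top[of 5] by eventually_elim simp
  \<comment> \<open>The exponent \<open>2 * k\<close> comes from \<open>le_half_square\<close>; the
    additional square is at least 4 and absorbs the summand 2.\<close>
  have "(n ^ k + 1) div 2 + 2 \<le> ((n + 1) div 2 + 2) ^ (2 * k + 2)" for n k :: nat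
  proof -
    let ?h = "(n + 1) div 2 + 2"
    have "n ^ k \<le> ?h ^ (2 * k)"
      unfolding power_mult by (intro power_mono le_half_square) auto
    moreover have "1 \<le> ?h ^ (2 * k)" by simp
    moreover have "2 ^ 2 \<le> ?h ^ 2" by (intro power_mono) auto
    then have "?h ^ (2 * k) * 4 \<le> ?h ^ (2 * k) * ?h ^ 2"
      by (intro mult_le_mono) auto
    ultimately show ?thesis by (simp only: power_add)
  qed
  then show "f_consistent (\<lambda>n. (n + 1) div 2 + 2)"
    unfolding f_consistent_def le_ae_def by (intro allI exI always_eventually)
qed (use counter_linear_half in auto)

lemma admissible_lg_iter: "admissible (\<lambda>n. (lg ^^ Suc m) n + 1)"
  unfolding admissible_def
proof (intro conjI)
  show "mono (\<lambda>n. (lg ^^ Suc m) n + 1)"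
    by (intro monoI add_mono monoD[OF mono_funpow_lg]) auto
  show "\<forall>n. 2 \<le> (lg ^^ Suc m) n + 1"
    using lg_ge_1 by (simp add: Suc_le_eq)
  have le: "(lg ^^ Suc m) n \<le> lg n" for n
  proof (induction m)
    case (Suc m)
    have "lg x \<le> x" if "1 \<le> x" for x
      using lg_le_half[of x] that by linarith
    then have "(lg ^^ Suc (Suc m)) n \<le> (lg ^^ Suc m) n"
      using lg_ge_1 by simp
    then show ?case using Suc by (rule le_trans)
  qed simp
  have "\<forall>\<^sub>F n in sequentially. (lg n + 1) ^ 1 \<le> n div 2"
    by (rule eventually_poly_lg_le)
  then show "(\<lambda>n. (lg ^^ Suc m) n + 1) \<le>\<^sub>a (\<lambda>n. n)"
    unfolding le_ae_def
  proof eventually_elim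
    case (elim n)
    then show ?case
      using le[of n] div_le_dividend[of n 2] unfolding power_one_right by linarith
  qed
  show "f_consistent (\<lambda>n. (lg ^^ Suc m) n + 1)"
    unfolding f_consistent_def le_ae_def
  proof
    fix k
    obtain c where c: "\<And>n. (lg ^^ Suc m) (n ^ k) \<le> c * (lg ^^ Suc m) n"
      using lg_iter_power_le by blast
    have "(lg ^^ Suc m) (n ^ k) + 1 \<le> ((lg ^^ Suc m) n + 1) ^ (c + 2)" for n
    proof -
      let ?x = "(lg ^^ Suc m) n + 1"
      have x: "?x \<ge> 2" using lg_ge_1 by (simp add: Suc_le_eq)
      \<comment> \<open>The constant factor from \<open>lg_iter_power_le\<close> is absorbed by a
        power of a base that is at least 2.\<close>
      have "c + 1 \<le> 2 ^ (c + 1)" using less_exp[of "c + 1"] by linarith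
      also have "\<dots> \<le> ?x ^ (c + 1)" using x by (intro power_mono) auto
      finally have "(c + 1) * ?x \<le> ?x ^ (c + 1) * ?x" by (intro mult_le_mono) auto
      moreover have "(c + 1) * ?x = c * (lg ^^ Suc m) n + c + ?x" by (simp add: algebra_simps)
      moreover have "?x ^ (c + 1) * ?x = ?x ^ (c + 2)" by simp
      ultimately show ?thesis using c[of n] x by linarith
    qed
    then show "\<exists>l. \<forall>\<^sub>F n in sequentially. (lg ^^ Suc m) (n ^ k) + 1 \<le> ((lg ^^ Suc m) n + 1) ^ l"
      by (intro exI[of _ "c + 2"] always_eventually allI)
  qed
  show "counter_linear (\<lambda>n. (lg ^^ Suc m) n + 1)"
    by (intro counter_linear_plus counter_linear_lg_iter)
qed

text \<open>For f-consistency: eventually \<open>lg (n ^ k) \<le> n\<close>, so passing from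
  \<open>n\<close> to \<open>n ^ k\<close> raises \<open>lstar\<close> by at most 1.\<close>

lemma admissible_lstar: "admissible (\<lambda>n. lstar n + 2)"
  unfolding admissible_def
proof (intro conjI)
  show "mono (\<lambda>n. lstar n + 2)"
    by (intro monoI add_mono monoD[OF mono_lstar]) auto
  have le: "lstar n \<le> Suc (lg n)" for n
    using lstar_le_Suc[of n] lstar_le[of "lg n"] by simp
  have "\<forall>\<^sub>F n in sequentially. (lg n + 3) ^ 1 \<le> n div 2"
    by (rule eventually_poly_lg_le)
  then show "(\<lambda>n. lstar n + 2) \<le>\<^sub>a (\<lambda>n. n)"
    unfolding le_ae_def
  proof eventually_elim
    case (elim n)
    then show ?case
      using le[of n] div_le_dividend[of n 2] unfolding power_one_right by linarith
  qed
  show "f_consistent (\<lambda>n. lstar n + 2)"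
    unfolding f_consistent_def le_ae_def
  proof
    fix k
    have "\<forall>\<^sub>F n in sequentially. lstar (n ^ k) + 2 \<le> (lstar n + 2) ^ 2"
      using eventually_poly_lg_le[of "Suc k" 2]
    proof eventually_elim
      case (elim n)
      have "Suc k * lg n \<le> (lg n + Suc k) ^ 2"
        unfolding power2_eq_square by (intro mult_le_mono) auto
      with elim have "Suc k * lg n \<le> n"
        using div_le_dividend[of n 2] by linarith
      then have "lg (n ^ k) \<le> n"
        using lg_power_le le_trans by blast
      then have "lstar (n ^ k) \<le> Suc (lstar n)"
        using lstar_le_Suc[of "n ^ k"] monoD[OF mono_lstar] by (meson Suc_le_mono le_trans)
      then show ?case by (simp add: power2_eq_square)
    qed
    then show "\<exists>l. \<forall>\<^sub>F n in sequentially. lstar (n ^ k) + 2 \<le> (lstar n + 2) ^ l" ..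
  qed
  show "counter_linear (\<lambda>n. lstar n + 2)"
    using counter_linear_plus[OF counter_linear_plus[OF counter_linear_lstar]] by simp
qed simp

lemma ll_pow_two:
  assumes "filterlim \<alpha> at_top sequentially"
  shows "(\<lambda>n. 2) \<lless>\<^sub>p\<^sub>o\<^sub>w \<alpha>"
  using assms unfolding ll_pow_def le_ae_def filterlim_at_top by blast

text \<open>With \<open>y\<close> the iterated logarithm on the right, \<open>lstar n\<close> is at
  most \<open>lg y + m + 2\<close>, and powers of that are negligible against
  \<open>y\<close>.\<close>

lemma ll_pow_lstar_lg_iter: "(\<lambda>n. lstar n + 2) \<lless>\<^sub>p\<^sub>o\<^sub>w (\<lambda>n. (lg ^^ Suc m) n + 1)"
  unfolding ll_pow_def le_ae_def
proof
  fix k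
  have "\<forall>\<^sub>F n in sequentially. (lg ((lg ^^ Suc m) n) + (m + 4)) ^ k \<le> (lg ^^ Suc m) n div 2"
    by (rule eventually_compose_filterlim[OF eventually_poly_lg_le filterlim_funpow_lg])
  then show "\<forall>\<^sub>F n in sequentially. (lstar n + 2) ^ k \<le> (lg ^^ Suc m) n + 1"
  proof eventually_elim
    case (elim n)
    let ?y = "(lg ^^ Suc m) n"
    have "lstar n + 2 \<le> lg ?y + (m + 4)"
      using lstar_le_iter[of n "Suc m"] lstar_le_Suc[of ?y] lstar_le[of "lg ?y"] by linarith
    then have "(lstar n + 2) ^ k \<le> (lg ?y + (m + 4)) ^ k"
      by (intro power_mono) auto
    then show ?case
      using elim div_le_dividend[of ?y 2] by linarith
  qed
qed

lemma ll_pow_lg_iter_Suc: "(\<lambda>n. (lg ^^ Suc (Suc m)) n + 1) \<lless>\<^sub>p\<^sub>o\<^sub>w (\<lambda>n. (lg ^^ Suc m) n + 1)"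
  unfolding ll_pow_def le_ae_def
proof
  fix k
  have "\<forall>\<^sub>F n in sequentially. (lg ((lg ^^ Suc m) n) + 1) ^ k \<le> (lg ^^ Suc m) n div 2"
    by (rule eventually_compose_filterlim[OF eventually_poly_lg_le filterlim_funpow_lg])
  then show "\<forall>\<^sub>F n in sequentially. ((lg ^^ Suc (Suc m)) n + 1) ^ k \<le> (lg ^^ Suc m) n + 1"
  proof eventually_elim
    case (elim n)
    then show ?case
      using div_le_dividend[of "(lg ^^ Suc m) n" 2]
      unfolding funpow.simps(2)[of "Suc m"] o_apply by linarith
  qed
qed

lemma ll_pow_lg_iter:
  assumes "m < m'"
  shows "(\<lambda>n. (lg ^^ Suc m') n + 1) \<lless>\<^sub>p\<^sub>o\<^sub>w (\<lambda>n. (lg ^^ Suc m) n + 1)"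
  using assms
proof (induction rule: less_Suc_induct)
  case (1 i)
  show ?case by (rule ll_pow_lg_iter_Suc)
next
  case (2 i j k)
  show ?case by (rule ll_pow_trans[OF 2(4) 2(3)])
qed

lemma ll_pow_lg_iter_half: "(\<lambda>n. (lg ^^ Suc m) n + 1) \<lless>\<^sub>p\<^sub>o\<^sub>w (\<lambda>n. (n + 1) div 2 + 2)"
proof -
  have 0: "(\<lambda>n. (lg ^^ Suc 0) n + 1) \<lless>\<^sub>p\<^sub>o\<^sub>w (\<lambda>n. (n + 1) div 2 + 2)"
    unfolding ll_pow_def le_ae_def
  proof
    fix k
    show "\<forall>\<^sub>F n in sequentially. ((lg ^^ Suc 0) n + 1) ^ k \<le> (n + 1) div 2 + 2"
      using eventually_poly_lg_le[of 1 k]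
    proof eventually_elim
      case (elim n)
      then show ?case using div_le_mono[of n "n + 1" 2] by simp
    qed
  qed
  show ?thesis
  proof (cases m)
    case (Suc m')
    then show ?thesis using ll_pow_trans[OF ll_pow_lg_iter 0, of m] by simp
  qed (use 0 in simp)
qed

section \<open>Limits of quotients, and equivalence of bounds\<close>

lemma ll_pow_ratio:
  assumes "\<alpha> \<lless>\<^sub>p\<^sub>o\<^sub>w \<alpha>'" "\<And>n. 2 \<le> \<alpha> n"
  shows "\<forall>\<^sub>F n in sequentially. 0 < n \<and> 2 ^ k * real (\<alpha> n) \<le> real (\<alpha>' n)"
  using ll_powD[OF assms(1), of "Suc k"] eventually_gt_at_top[of 0]
proof eventually_elim
  case (elim n)
  \<comment> \<open>Of the \<open>Suc k\<close> factors \<open>\<alpha> n\<close>, one is kept and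
    the others are bounded below by 2.\<close>
  have "2 ^ k * \<alpha> n \<le> \<alpha> n ^ k * \<alpha> n"
    by (intro mult_le_mono power_mono assms(2)) auto
  also have "\<dots> \<le> \<alpha>' n"
    using elim by (simp add: mult.commute)
  finally have "2 ^ k * \<alpha> n \<le> \<alpha>' n" .
  then have "real (2 ^ k * \<alpha> n) \<le> real (\<alpha>' n)" by (simp only: of_nat_le_iff)
  then show ?case using elim by simp
qed

lemma ll_pow_ratio_tendsto_0:
  assumes "\<alpha> \<lless>\<^sub>p\<^sub>o\<^sub>w \<alpha>'" "\<And>n. 2 \<le> \<alpha> n" "\<And>n. 2 \<le> \<alpha>' n"
  shows "(\<lambda>n. real (n * \<alpha> n) / real (n * \<alpha>' n)) \<longlonglongrightarrow> 0"
proof (rule tendstoI)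
  fix e :: real assume "e > 0"
  then obtain k where k: "(1 / 2) ^ k < e"
    using real_arch_pow_inv[of e "1 / 2"] by auto
  show "\<forall>\<^sub>F n in sequentially. dist (real (n * \<alpha> n) / real (n * \<alpha>' n)) 0 < e"
    using ll_pow_ratio[OF assms(1,2), of k]
  proof eventually_elim
    case (elim n)
    have "real (\<alpha> n) / real (\<alpha>' n) \<le> (1 / 2) ^ k"
      using elim assms(3)[of n] by (simp add: field_simps)
    then show ?case using elim k by simp
  qed
qed

lemma ll_pow_ratio_at_top:
  assumes "\<alpha> \<lless>\<^sub>p\<^sub>o\<^sub>w \<alpha>'" "\<And>n. 2 \<le> \<alpha> n"
  shows "filterlim (\<lambda>n. real (n * \<alpha>' n) / real (n * \<alpha> n)) at_top sequentially"
  unfolding filterlim_at_top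
proof
  fix Z :: real
  obtain k where k: "Z < 2 ^ k"
    using real_arch_pow[of 2 Z] by auto
  show "\<forall>\<^sub>F n in sequentially. Z \<le> real (n * \<alpha>' n) / real (n * \<alpha> n)"
    using ll_pow_ratio[OF assms, of k]
  proof eventually_elim
    case (elim n)
    have "2 ^ k \<le> real (\<alpha>' n) / real (\<alpha> n)"
      using elim assms(2)[of n] by (simp add: field_simps)
    then show ?case using elim k by simp
  qed
qed

text \<open>Admissibility is asked of \<open>\<alpha>'\<close> alone because \<alpha> will be the
  raw factor of a given bound, such as \<open>n ^ Suc j\<close>, which may exceed
  \<open>n\<close>.\<close>

lemma equiv_it_if_power_bounds:
  fixes \<alpha> \<alpha>' :: "nat \<Rightarrow> nat"
  assumes "mono \<alpha>" "admissible \<alpha>'"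
    and "\<forall>\<^sub>F n in sequentially. \<alpha> n \<le> \<alpha>' n ^ k" "\<forall>\<^sub>F n in sequentially. \<alpha>' n \<le> \<alpha> n ^ l"
    and "\<forall>\<^sub>F n in sequentially. 1 \<le> \<alpha> n"
  shows "(\<lambda>n. n * \<alpha> n) \<equiv>\<^sub>i\<^sub>t (\<lambda>n. n * \<alpha>' n)"
proof -
  have "\<forall>\<^sub>F n in sequentially. 1 \<le> \<alpha>' n"
    using admissibleD(2)[OF assms(2)] by (intro always_eventually allI) (meson le_trans one_le_numeral)
  then show ?thesis
    unfolding equiv_it_def using le_it_if_power_bound assms admissibleD(1)[OF assms(2)] by blast
qed

theorem theorem1:
  shows "\<exists>U1 :: (nat \<Rightarrow> nat) set.
    (\<forall>\<beta>\<in>U1. type1 \<beta>) \<and>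
    tame U1 \<and>
    (B_lin \<union> B_lgstar \<union> (\<Union>m\<in>{1..}. B_qlin m) \<union> B_pol) - {\<lambda>n. n} \<hookrightarrow>\<^sub>i\<^sub>t U1 \<and>
    densely_linearly_ordered_it U1 \<and>
    (\<forall>\<beta>1\<in>U1. \<forall>\<beta>2\<in>U1. \<forall>\<alpha>1 \<alpha>2.
       type1_factor \<alpha>1 \<beta>1 \<longrightarrow> type1_factor \<alpha>2 \<beta>2 \<longrightarrow>
       (\<beta>1 \<prec>\<^sub>i\<^sub>t \<beta>2 \<longleftrightarrow> \<alpha>1 \<lless>\<^sub>p\<^sub>o\<^sub>w \<alpha>2))"
proof -
  define c2 where "c2 = (\<lambda>n::nat. 2::nat)"
  define ls where "ls = (\<lambda>n. lstar n + 2)"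
  define lm where "lm = (\<lambda>m n. (lg ^^ Suc m) n + 1)"
  \<comment> \<open>This represents \<open>B_pol\<close>; the factor \<open>n\<close> itself is not at least \<open>2\<close> everywhere.\<close>
  define hf where "hf = (\<lambda>n::nat. (n + 1) div 2 + 2)"
  have admissible: "admissible c2" "admissible ls" "admissible (lm m)" "admissible hf" for m
    unfolding c2_def ls_def lm_def hf_def
    by (rule admissible_two admissible_lstar admissible_lg_iter admissible_half)+
  have "filterlim ls at_top sequentially"
    unfolding ls_def by (rule filterlim_at_top_mono[OF filterlim_lstar]) simp
  then have o1: "c2 \<lless>\<^sub>p\<^sub>o\<^sub>w ls"
    unfolding c2_def by (rule ll_pow_two)
  have o2: "ls \<lless>\<^sub>p\<^sub>o\<^sub>w lm m" for m
    unfolding ls_def lm_def by (rule ll_pow_lstar_lg_iter)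
  have o3: "lm m' \<lless>\<^sub>p\<^sub>o\<^sub>w lm m" if "m < m'" for m m'
    unfolding lm_def using that by (rule ll_pow_lg_iter)
  have o4: "lm m \<lless>\<^sub>p\<^sub>o\<^sub>w hf" for m
    unfolding lm_def hf_def by (rule ll_pow_lg_iter_half)
  have o5: "c2 \<lless>\<^sub>p\<^sub>o\<^sub>w lm m" "ls \<lless>\<^sub>p\<^sub>o\<^sub>w hf" "c2 \<lless>\<^sub>p\<^sub>o\<^sub>w hf" for m
    using o1 o2 o4 ll_pow_trans by blast+
  have D: "\<forall>x\<in>Collect admissible. \<forall>y\<in>Collect admissible. x \<lless>\<^sub>p\<^sub>o\<^sub>w y \<longrightarrow>
      (\<exists>z\<in>Collect admissible. x \<lless>\<^sub>p\<^sub>o\<^sub>w z \<and> z \<lless>\<^sub>p\<^sub>o\<^sub>w y)"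
    using admissible_midpoint ll_pow_midpoint_left ll_pow_midpoint_right by blast
  have S: "{c2, ls, hf} \<union> range lm \<subseteq> Collect admissible"
    using admissible by auto
  have "lm m \<lless>\<^sub>p\<^sub>o\<^sub>w lm m' \<or> lm m' \<lless>\<^sub>p\<^sub>o\<^sub>w lm m" if "lm m \<noteq> lm m'" for m m'
    using that o3 by (cases m m' rule: linorder_cases) auto
  then have T: "\<forall>x\<in>{c2, ls, hf} \<union> range lm. \<forall>y\<in>{c2, ls, hf} \<union> range lm.
      x \<noteq> y \<longrightarrow> x \<lless>\<^sub>p\<^sub>o\<^sub>w y \<or> y \<lless>\<^sub>p\<^sub>o\<^sub>w x"
    using o1 o2 o4 o5 by auto
  have "transp ll_pow"
    by (intro transpI) (rule ll_pow_trans)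
  from dense_maximal_chain[OF this D S T]
  obtain C where C: "{c2, ls, hf} \<union> range lm \<subseteq> C" "C \<subseteq> Collect admissible"
    and chain': "\<forall>x\<in>C. \<forall>y\<in>C. x \<noteq> y \<longrightarrow> x \<lless>\<^sub>p\<^sub>o\<^sub>w y \<or> y \<lless>\<^sub>p\<^sub>o\<^sub>w x"
    and dense': "\<forall>x\<in>C. \<forall>y\<in>C. x \<lless>\<^sub>p\<^sub>o\<^sub>w y \<longrightarrow> (\<exists>z\<in>C. x \<lless>\<^sub>p\<^sub>o\<^sub>w z \<and> z \<lless>\<^sub>p\<^sub>o\<^sub>w y)"
    by (elim exE conjE) (rule that)
  have chain: "x \<lless>\<^sub>p\<^sub>o\<^sub>w y \<or> y \<lless>\<^sub>p\<^sub>o\<^sub>w x" if "x \<in> C" "y \<in> C" "x \<noteq> y" for x y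
    using chain' that by simp
  have dense: "\<exists>z\<in>C. x \<lless>\<^sub>p\<^sub>o\<^sub>w z \<and> z \<lless>\<^sub>p\<^sub>o\<^sub>w y"
    if "x \<in> C" "y \<in> C" "x \<lless>\<^sub>p\<^sub>o\<^sub>w y" for x y
    using dense' that by simp
  define U where "U = (\<lambda>\<alpha> n. n * \<alpha> n) ` C"
  have C_admissible: "admissible \<alpha>" if "\<alpha> \<in> C" for \<alpha>
    using C(2) that by blast
  \<comment> \<open>For the converse, the chain leaves only \<open>x = y\<close> or \<open>y\<close>
    below \<open>x\<close>, and either excludes a strict increase from \<open>x\<close> to
    \<open>y\<close>.\<close>
  have iff: "(\<lambda>n. n * x n) \<prec>\<^sub>i\<^sub>t (\<lambda>n. n * y n) \<longleftrightarrow> x \<lless>\<^sub>p\<^sub>o\<^sub>w y" if "x \<in> C" "y \<in> C" for x y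
    using that chain[OF that] ll_pow_less_it[of x y] ll_pow_less_it[of y x] C_admissible
    by (auto simp: less_it_def equiv_it_def)
  have "type1 \<beta>" if "\<beta> \<in> U" for \<beta>
    using that admissible_type1_factor C_admissible unfolding U_def type1_def by blast
  moreover have "tame U"
    unfolding tame_def
  proof (intro conjI ballI)
    fix \<beta> assume "\<beta> \<in> U"
    then show "is_bound \<beta>"
      using admissible_type1_factor C_admissible unfolding U_def type1_factor_def by blast
  next
    fix \<beta>1 \<beta>2 assume "\<beta>1 \<in> U" "\<beta>2 \<in> U"
    then obtain x y where xy: "x \<in> C" "y \<in> C" "\<beta>1 = (\<lambda>n. n * x n)" "\<beta>2 = (\<lambda>n. n * y n)"
      unfolding U_def by blast
    have ge: "\<And>n. 2 \<le> x n" "\<And>n. 2 \<le> y n"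
      using admissibleD(2) C_admissible xy by blast+
    consider "x = y" | "x \<lless>\<^sub>p\<^sub>o\<^sub>w y" | "y \<lless>\<^sub>p\<^sub>o\<^sub>w x"
      using chain xy by blast
    then show "(\<exists>l. (\<lambda>n. real (\<beta>1 n) / real (\<beta>2 n)) \<longlonglongrightarrow> l) \<or>
        filterlim (\<lambda>n. real (\<beta>1 n) / real (\<beta>2 n)) at_top sequentially"
    proof cases
      case 1
      have "\<forall>\<^sub>F n in sequentially. 1 = real (\<beta>1 n) / real (\<beta>2 n)"
        using eventually_gt_at_top[of 0]
      proof eventually_elim
        case (elim n)
        then show ?case using ge(1)[of n] 1 xy by simp
      qed
      then have "(\<lambda>n. real (\<beta>1 n) / real (\<beta>2 n)) \<longlonglongrightarrow> 1"
        by (rule Lim_transform_eventually[OF tendsto_const])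
      then show ?thesis by blast
    next
      case 2
      then show ?thesis using ll_pow_ratio_tendsto_0[OF 2 ge] xy by blast
    next
      case 3
      then show ?thesis using ll_pow_ratio_at_top[OF 3 ge(2)] xy by simp
    qed
  qed
  moreover have "(B_lin \<union> B_lgstar \<union> (\<Union>m\<in>{1..}. B_qlin m) \<union> B_pol) - {\<lambda>n. n} \<hookrightarrow>\<^sub>i\<^sub>t U"
    unfolding embeds_it_def
  proof
    fix \<beta> assume \<beta>: "\<beta> \<in> (B_lin \<union> B_lgstar \<union> (\<Union>m\<in>{1..}. B_qlin m) \<union> B_pol) - {\<lambda>n. n}"
    have U: "(\<lambda>n. n * \<alpha> n) \<in> U" if "\<alpha> \<in> {c2, ls, hf} \<union> range lm" for \<alpha>
      using that C(1) unfolding U_def by blast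
    consider (lin) "\<beta> \<in> B_lin" | (lgstar) "\<beta> \<in> B_lgstar" | (qlin) m where "m \<ge> 1" "\<beta> \<in> B_qlin m"
      | (pol) "\<beta> \<in> B_pol"
      using \<beta> by auto
    then show "\<exists>\<beta>'\<in>U. \<beta> \<equiv>\<^sub>i\<^sub>t \<beta>'"
    proof cases
      case lin
      then obtain c where c: "\<beta> = (\<lambda>n. c * n)" "c \<ge> 1"
        by (auto simp: B_lin_def)
      then have "c \<noteq> 1" using \<beta> by auto
      \<comment> \<open>The witnesses are \<open>c \<le> 2 ^ c\<close> and \<open>2 \<le> c\<close>;
        the latter is where removing the identity matters.\<close>
      with c have "(\<lambda>n. n * c) \<equiv>\<^sub>i\<^sub>t (\<lambda>n. n * c2 n)"
        using less_exp[of c]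
        by (intro equiv_it_if_power_bounds[where k = c and l = 1] admissible) (auto simp: c2_def mono_def)
      then show ?thesis using U[of c2] c by (auto simp: mult.commute)
    next
      case lgstar
      then obtain k where k: "\<beta> = (\<lambda>n. n * lgstar n ^ k)" "k \<ge> 1"
        by (auto simp: B_lgstar_def)
      \<comment> \<open>The deviating value of \<open>lgstar\<close> at 0 disappears in the product
        with \<open>n\<close>.\<close>
      have eq: "\<beta> = (\<lambda>n. n * lstar n ^ k)"
      proof
        fix n
        show "\<beta> n = n * lstar n ^ k"
          unfolding k by (cases "n = 0") (auto simp: lgstar_eq_lstar)
      qed
      have ge: "\<forall>\<^sub>F n in sequentially. 2 \<le> lstar n"
        using filterlim_lstar unfolding filterlim_at_top by blast
      have "(\<lambda>n. n * lstar n ^ k) \<equiv>\<^sub>i\<^sub>t (\<lambda>n. n * ls n)"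
      proof (rule equiv_it_if_power_bounds[where k = k and l = 2])
        show "mono (\<lambda>n. lstar n ^ k)"
          by (intro monoI power_mono monoD[OF mono_lstar]) auto
        show "\<forall>\<^sub>F n in sequentially. lstar n ^ k \<le> ls n ^ k"
          by (intro always_eventually allI power_mono) (auto simp: ls_def)
        show "\<forall>\<^sub>F n in sequentially. ls n \<le> (lstar n ^ k) ^ 2"
          using ge
        proof eventually_elim
          case (elim n)
          have "lstar n ^ 1 \<le> lstar n ^ k" using elim k by (intro power_increasing) auto
          then have "lstar n * lstar n \<le> (lstar n ^ k) ^ 2"
            unfolding power2_eq_square by (intro mult_le_mono) auto
          moreover have "2 * lstar n \<le> lstar n * lstar n"
            using elim by (intro mult_le_mono) auto
          ultimately show ?case using elim unfolding ls_def by linarith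
        qed
        show "\<forall>\<^sub>F n in sequentially. 1 \<le> lstar n ^ k"
          using ge by eventually_elim simp
      qed (rule admissible)
      then show ?thesis using U[of ls] eq by auto
    next
      case (qlin m)
      then obtain i where i: "m = Suc i" by (cases m) auto
      obtain k where k: "\<beta> = (\<lambda>n. n * (lg ^^ m) n ^ k)" "k \<ge> 1"
        using qlin by (auto simp: B_qlin_def)
      have ge: "\<forall>\<^sub>F n in sequentially. 2 \<le> (lg ^^ m) n"
        using filterlim_funpow_lg unfolding filterlim_at_top by blast
      have "(\<lambda>n. n * (lg ^^ m) n ^ k) \<equiv>\<^sub>i\<^sub>t (\<lambda>n. n * lm i n)"
      proof (rule equiv_it_if_power_bounds[where k = k and l = 2])
        show "mono (\<lambda>n. (lg ^^ m) n ^ k)"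
          by (intro monoI power_mono monoD[OF mono_funpow_lg]) auto
        show "\<forall>\<^sub>F n in sequentially. (lg ^^ m) n ^ k \<le> lm i n ^ k"
          by (intro always_eventually allI power_mono) (auto simp: lm_def i)
        show "\<forall>\<^sub>F n in sequentially. lm i n \<le> ((lg ^^ m) n ^ k) ^ 2"
          using ge
        proof eventually_elim
          case (elim n)
          have "(lg ^^ m) n ^ 1 \<le> (lg ^^ m) n ^ k" using elim k by (intro power_increasing) auto
          then have "(lg ^^ m) n * (lg ^^ m) n \<le> ((lg ^^ m) n ^ k) ^ 2"
            unfolding power2_eq_square by (intro mult_le_mono) auto
          moreover have "2 * (lg ^^ m) n \<le> (lg ^^ m) n * (lg ^^ m) n"
            using elim by (intro mult_le_mono) auto
          ultimately show ?case using elim unfolding lm_def i by linarith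
        qed
        show "\<forall>\<^sub>F n in sequentially. 1 \<le> (lg ^^ m) n ^ k"
          using ge by eventually_elim simp
      qed (rule admissible)
      then show ?thesis using U[of "lm i"] k by auto
    next
      case pol
      then obtain k where k: "\<beta> = (\<lambda>n. n ^ k)" "k \<ge> 1"
        by (auto simp: B_pol_def)
      \<comment> \<open>With the identity removed, \<open>k\<close> is at least 2, so a factor of
        positive degree remains after splitting off \<open>n\<close>.\<close>
      then have "k \<noteq> 1" using \<beta> by auto
      with k obtain j where j: "k = Suc (Suc j)"
        by (metis One_nat_def Suc_le_D Suc_n_not_le_n not0_implies_Suc)
      have "(\<lambda>n. n * n ^ Suc j) \<equiv>\<^sub>i\<^sub>t (\<lambda>n. n * hf n)"
      proof (rule equiv_it_if_power_bounds[where k = "2 * Suc j" and l = 1])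
        show "mono (\<lambda>n::nat. n ^ Suc j)"
          by (intro monoI power_mono) auto
        have "n ^ Suc j \<le> hf n ^ (2 * Suc j)" for n
          unfolding power_mult hf_def by (intro power_mono le_half_square) auto
        then show "\<forall>\<^sub>F n in sequentially. n ^ Suc j \<le> hf n ^ (2 * Suc j)"
          by (intro always_eventually allI)
        show "\<forall>\<^sub>F n in sequentially. hf n \<le> (n ^ Suc j) ^ 1"
          using eventually_ge_at_top[of 5]
        proof eventually_elim
          case (elim n)
          have "n ^ 1 \<le> n ^ Suc j" using elim by (intro power_increasing) auto
          moreover have "hf n \<le> n" using elim unfolding hf_def by presburger
          ultimately show ?case unfolding power_one_right by linarith
        qed
        show "\<forall>\<^sub>F n in sequentially. 1 \<le> n ^ Suc j"
          using eventually_ge_at_top[of 1] by eventually_elim simp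
      qed (rule admissible)
      then show ?thesis using U[of hf] k j by auto
    qed
  qed
  moreover have "densely_linearly_ordered_it U"
    unfolding densely_linearly_ordered_it_def
  proof (intro conjI ballI impI)
    fix \<beta>1 \<beta>2 assume "\<beta>1 \<in> U" "\<beta>2 \<in> U"
    then obtain x y where xy: "x \<in> C" "y \<in> C" "\<beta>1 = (\<lambda>n. n * x n)" "\<beta>2 = (\<lambda>n. n * y n)"
      unfolding U_def by blast
    show "\<beta>1 \<prec>\<^sub>i\<^sub>t \<beta>2 \<or> \<beta>2 \<prec>\<^sub>i\<^sub>t \<beta>1" if "\<beta>1 \<noteq> \<beta>2"
    proof -
      have "x \<noteq> y" using that xy by auto
      then show ?thesis using chain iff xy by simp
    qed
    show "\<not> (\<beta>1 \<prec>\<^sub>i\<^sub>t \<beta>2 \<and> \<beta>2 \<prec>\<^sub>i\<^sub>t \<beta>1)"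
      by (auto simp: less_it_def equiv_it_def)
    show "\<exists>\<beta>3\<in>U. \<beta>1 \<prec>\<^sub>i\<^sub>t \<beta>3 \<and> \<beta>3 \<prec>\<^sub>i\<^sub>t \<beta>2" if "\<beta>1 \<prec>\<^sub>i\<^sub>t \<beta>2"
    proof -
      have "x \<lless>\<^sub>p\<^sub>o\<^sub>w y"
        using that iff[OF xy(1,2)] xy by simp
      then obtain z where z: "z \<in> C" "x \<lless>\<^sub>p\<^sub>o\<^sub>w z" "z \<lless>\<^sub>p\<^sub>o\<^sub>w y"
        using dense[OF xy(1,2)] by blast
      then show ?thesis
        unfolding xy U_def using iff[OF xy(1) z(1)] iff[OF z(1) xy(2)]
        by (intro bexI[of _ "\<lambda>n. n * z n"] conjI imageI) simp_all
    qed
  qed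
  moreover have less_iff: "\<beta>1 \<prec>\<^sub>i\<^sub>t \<beta>2 \<longleftrightarrow> \<alpha>1 \<lless>\<^sub>p\<^sub>o\<^sub>w \<alpha>2"
    if b: "\<beta>1 \<in> U" "\<beta>2 \<in> U" and f: "type1_factor \<alpha>1 \<beta>1" "type1_factor \<alpha>2 \<beta>2" for \<beta>1 \<beta>2 \<alpha>1 \<alpha>2
  proof -
    obtain x y where xy: "x \<in> C" "y \<in> C" "\<beta>1 = (\<lambda>n. n * x n)" "\<beta>2 = (\<lambda>n. n * y n)"
      using b unfolding U_def by blast
    \<comment> \<open>A bound determines its factor except at 0, where the product vanishes;
      \<open>ll_pow\<close> ignores that single value.\<close>
    have eq: "\<alpha>1 n = x n" "\<alpha>2 n = y n" if "0 < n" for n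
    proof -
      have "n * x n = n * \<alpha>1 n" "n * y n = n * \<alpha>2 n"
        using f xy by (auto simp: type1_factor_def fun_eq_iff)
      then show "\<alpha>1 n = x n" "\<alpha>2 n = y n" using that by auto
    qed
    have "(\<forall>\<^sub>F n in sequentially. \<alpha>1 n ^ k \<le> \<alpha>2 n) \<longleftrightarrow> (\<forall>\<^sub>F n in sequentially. x n ^ k \<le> y n)" for k
      by (rule eventually_cong[OF eventually_gt_at_top[of 0]]) (simp add: eq)
    then show ?thesis
      using iff xy by (simp add: ll_pow_def le_ae_def)
  qed
  ultimately show ?thesis
    by (intro exI[of _ U] conjI ballI allI impI less_iff)
qed

end
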